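(* For every $(2,3)$-bipartite graph $G$, we have $ch'_s(G)\leq 6$. That is, for every $(2,3)$-bipartite graph $G$ and every assignment $L$ of a list $L(e)$ of colors with $|L(e)|\geq 6$ to each edge $e\in E(G)$, there is a strong edge-coloring $c$ of $G$ with $c(e)\in L(e)$ for every $e\in E(G)$.
   Context: All graphs are finite, undirected and without loops; "graph" (as opposed to "multigraph") means no parallel edges. For integers $d_A,d_B$, a $(d_A,d_B)$-bipartite graph is a bipartite graph with parts $A$ and $B$ such that every vertex of $A$ has degree at most $d_A$ and every vertex of $B$ has degree at most $d_B$. A strong edge-coloring of a graph $G$ is a proper edge-coloring of $G$ (edges sharing an endpoint get different colors) such that moreover every two edges joined by another edge (i.e. an edge having one endpoint in each of them) are colored differently. Given a list $L(e)$ of available colors for every edge $e$, a list strong edge-coloring is a strong edge-coloring $c$ with $c(e)\in L(e)$ for every edge $e$. The strong edge-choosability $ch'_s(G)$ is the smallest number $k$ such that for every list assignment $L$ with $|L(e)|\geq k$ for all $e\in E(G)$, the graph $G$ admits a list strong edge-coloring. *)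

theory Defs
  imports Main
begin

text \<open>
  A finite simple graph is given by its vertex set \<open>V\<close> and its edge set \<open>E\<close>, whose members are
  two-element sets of vertices; so there are no loops and no parallel edges.
\<close>

definition simple_graph :: "'a set \<Rightarrow> 'a set set \<Rightarrow> bool" where
  "simple_graph V E \<longleftrightarrow> finite V \<and> (\<forall>e\<in>E. e \<subseteq> V \<and> card e = 2)"

definition degree :: "'a set set \<Rightarrow> 'a \<Rightarrow> nat" where
  "degree E v = card {e \<in> E. v \<in> e}"

definition bipartition :: "'a set \<Rightarrow> 'a set set \<Rightarrow> 'a set \<Rightarrow> 'a set \<Rightarrow> bool" where
  "bipartition V E A B \<longleftrightarrow> A \<union> B = V \<and> A \<inter> B = {} \<and> (\<forall>e\<in>E. \<exists>a\<in>A. \<exists>b\<in>B. e = {a, b})"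

definition degree_bipartite_graph :: "nat \<Rightarrow> nat \<Rightarrow> 'a set \<Rightarrow> 'a set set \<Rightarrow> bool" where
  "degree_bipartite_graph dA dB V E \<longleftrightarrow>
     simple_graph V E \<and>
     (\<exists>A B. bipartition V E A B \<and> (\<forall>a\<in>A. degree E a \<le> dA) \<and> (\<forall>b\<in>B. degree E b \<le> dB))"

definition proper_edge_coloring :: "'a set set \<Rightarrow> ('a set \<Rightarrow> 'c) \<Rightarrow> bool" where
  "proper_edge_coloring E c \<longleftrightarrow> (\<forall>e\<in>E. \<forall>f\<in>E. e \<noteq> f \<and> e \<inter> f \<noteq> {} \<longrightarrow> c e \<noteq> c f)"

definition joined_by_edge :: "'a set set \<Rightarrow> 'a set \<Rightarrow> 'a set \<Rightarrow> bool" where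
  "joined_by_edge E e f \<longleftrightarrow> (\<exists>x\<in>e. \<exists>y\<in>f. {x, y} \<in> E)"

definition strong_edge_coloring :: "'a set set \<Rightarrow> ('a set \<Rightarrow> 'c) \<Rightarrow> bool" where
  "strong_edge_coloring E c \<longleftrightarrow>
     proper_edge_coloring E c \<and>
     (\<forall>e\<in>E. \<forall>f\<in>E. e \<noteq> f \<and> joined_by_edge E e f \<longrightarrow> c e \<noteq> c f)"

definition list_strong_edge_coloring ::
    "'a set set \<Rightarrow> ('a set \<Rightarrow> 'c set) \<Rightarrow> ('a set \<Rightarrow> 'c) \<Rightarrow> bool" where
  "list_strong_edge_coloring E L c \<longleftrightarrow> strong_edge_coloring E c \<and> (\<forall>e\<in>E. c e \<in> L e)"

text \<open>
  Lists are sets of colors and may be infinite; since \<open>card\<close> is 0 on infinite sets, these have to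
  be admitted separately in the condition that a list has at least \<open>k\<close> elements.
\<close>

definition lists_of_size_at_least :: "nat \<Rightarrow> 'a set set \<Rightarrow> ('a set \<Rightarrow> 'c set) \<Rightarrow> bool" where
  "lists_of_size_at_least k E L \<longleftrightarrow> (\<forall>e\<in>E. infinite (L e) \<or> k \<le> card (L e))"

text \<open>
  The colors are natural numbers here. As the graph is finite and lists may be shrunk to \<open>k\<close>
  elements, only finitely many colors matter, so every infinite color type gives the same number.
  The set of admissible \<open>k\<close> is nonempty for finite \<open>E\<close> (greedily, \<open>card E\<close> belongs to it).
\<close>

definition strong_edge_choosability :: "'a set set \<Rightarrow> nat" where
  "strong_edge_choosability E =
     (LEAST k. \<forall>L :: 'a set \<Rightarrow> nat set.
        lists_of_size_at_least k E L \<longrightarrow> (\<exists>c. list_strong_edge_coloring E L c))"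

end

theory Submission
  imports Defs
begin

text \<open>
  Say that two edges conflict if a strong coloring has to separate them. An edge conflicts with at most
  seven others: one at its end of degree two, two at the other end, and two beyond each end. With six
  colors, greedy coloring therefore gets past every edge that still has two uncolored conflicts.

  Call a set \<open>T\<close> of edges extendable if adding it to a colorable set outside \<open>T\<close> yields a colorable set.
  An edge with two conflicts in an extendable set can be absorbed by it. Conflicts are adjacency in
  the square of the line graph, and this makes growth stop only at whole components
  (\<open>closed_if_saturated\<close>). It remains to find one small extendable set to start from in each component
  (\<open>colorable_if_reducible\<close>).

  If a vertex in the component is not of full degree, two edges near it do (\<open>low_degree_reducible\<close>).
  Otherwise the component is a cubic multigraph with every edge subdivided, and its edges are the
  half-edges of that multigraph. However the outside of a set of half-edges is colored, a member with
  \<open>d\<close> conflicts inside keeps at least \<open>d - 1\<close> colors, and one more if it has only six conflicts in all.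
  These lists suffice for the half-edges at the two vertices of a digon (\<open>digon_reducible\<close>: a complete
  graph on six vertices without one edge, except in the case of three parallel edges, which is easy)
  and for those in a triangle (\<open>triangle_reducible\<close>: an octahedron, which is 3-choosable). Without
  digons and triangles take any edge of the multigraph together with the four edges next to it
  (\<open>open_edge_reducible\<close>). Once the halves \<open>z\<close>, \<open>y\<close> of the middle edge are colored, the two sides are
  independent. For colors from suitable sets of two, a side can be completed unless \<open>z\<close> and \<open>y\<close> get one
  particular pair of colors (\<open>completes_star_flexible\<close>), and two such restrictions do not exhaust the
  choices (\<open>flexible_compatible\<close>).
\<close>

section \<open>Choosing colors from small lists\<close>

lemma card_ge2_obtain:
  assumes "2 \<le> card A" obtains a b where "a \<in> A" "b \<in> A" "a \<noteq> b"
  using assms that by (auto simp: card_le_Suc_iff numeral_eq_Suc)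

lemma card_ge3_obtain:
  assumes "3 \<le> card A" obtains a b c where "a \<in> A" "b \<in> A" "c \<in> A" "a \<noteq> b" "a \<noteq> c" "b \<noteq> c"
  using assms that by (auto simp: card_le_Suc_iff numeral_eq_Suc)

lemma one_of_three_avoids_two:
  assumes "X \<noteq> Y" "X \<noteq> Z" "Y \<noteq> Z"
  shows "X \<noteq> P \<and> X \<noteq> Q \<or> Y \<noteq> P \<and> Y \<noteq> Q \<or> Z \<noteq> P \<and> Z \<noteq> Q"
  using assms by blast

lemma transversal_avoiding_two_pairs_aux:
  assumes A: "2 \<le> card A" and B: "2 \<le> card B" and b: "b \<in> B" "b \<notin> A"
  shows "\<exists>x\<in>A. \<exists>y\<in>B. x \<noteq> y \<and> {x, y} \<noteq> P \<and> {x, y} \<noteq> Q"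
proof -
  obtain a a' where a: "a \<in> A" "a' \<in> A" "a \<noteq> a'"
    using A by (rule card_ge2_obtain)
  obtain b' where b': "b' \<in> B" "b' \<noteq> b"
    using B by (rule card_ge2_obtain) blast
  obtain a'' where a'': "a'' \<in> A" "a'' \<noteq> b'"
    using a by metis
  have "{a, b} \<noteq> {a', b}" "{a, b} \<noteq> {a'', b'}" "{a', b} \<noteq> {a'', b'}"
    using a a'' b b' by (auto simp: doubleton_eq_iff)
  note one_of_three_avoids_two[OF this, of P Q]
  moreover have "a \<noteq> b" "a' \<noteq> b" using a b by auto
  ultimately show ?thesis
    using a a'' b b' by blast
qed

text \<open>
  Unless \<open>A = B\<close> is itself a pair, the pairs meeting both \<open>A\<close> and \<open>B\<close> in different elements number at
  least three, so two forbidden ones leave a choice.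
\<close>

lemma transversal_avoiding_two_pairs:
  assumes A: "2 \<le> card A" and B: "2 \<le> card B" and ne: "\<not> (A = B \<and> (A = P \<or> A = Q))"
  shows "\<exists>x\<in>A. \<exists>y\<in>B. x \<noteq> y \<and> {x, y} \<noteq> P \<and> {x, y} \<noteq> Q"
proof (cases "A = B")
  case True
  show ?thesis
  proof (cases "3 \<le> card A")
    case True
    then obtain a b c where "a \<in> A" "b \<in> A" "c \<in> A" "a \<noteq> b" "a \<noteq> c" "b \<noteq> c"
      by (rule card_ge3_obtain)
    moreover from this have "{a, b} \<noteq> {a, c}" "{a, b} \<noteq> {b, c}" "{a, c} \<noteq> {b, c}"
      by (auto simp: doubleton_eq_iff)
    note one_of_three_avoids_two[OF this, of P Q]
    ultimately show ?thesis
      using \<open>A = B\<close> by blast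
  next
    case False
    then have "card A = 2" using A by simp
    then obtain a b where "A = {a, b}" "a \<noteq> b" by (auto simp: card_2_iff)
    with \<open>A = B\<close> ne show ?thesis by auto
  qed
next
  case False
  then consider b where "b \<in> B" "b \<notin> A" | b where "b \<in> A" "b \<notin> B" by blast
  then show ?thesis
  proof cases
    case 1
    with A B show ?thesis by (rule transversal_avoiding_two_pairs_aux)
  next
    case 2
    obtain x y where "x \<in> B" "y \<in> A" "x \<noteq> y" "{x, y} \<noteq> P" "{x, y} \<noteq> Q"
      using transversal_avoiding_two_pairs_aux[OF B A 2, of P Q] by blast
    then have "{y, x} \<noteq> P \<and> {y, x} \<noteq> Q" by (subst (1 2) insert_commute) simp
    with \<open>x \<in> B\<close> \<open>y \<in> A\<close> \<open>x \<noteq> y\<close> show ?thesis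
      by (intro bexI[of _ y] bexI[of _ x]) simp_all
  qed
qed

lemma card_2_neq_pair:
  assumes "card X = 2" "X \<noteq> {p, q}" shows "\<exists>s\<in>X. s \<notin> {p, q}"
  using assms by (auto simp: card_2_iff doubleton_eq_iff)

lemma fresh_color:
  assumes "finite S" "card S < card A" obtains a where "a \<in> A" "a \<notin> S"
  using assms by (metis card_mono leD subsetI)

lemma ex_fresh_color:
  assumes "card S \<le> n" "finite S" "n < card A" shows "\<exists>a\<in>A. a \<notin> S"
  using fresh_color[of S A] assms by (metis le_less_trans)

lemma card_small_insert_le: "card {a, b} \<le> 2" "card {a, b, c} \<le> 3" "card {a, b, c, d} \<le> 4"
  by (simp_all add: card_insert_if)

text \<open>
  The 4-cycle is 2-choosable: \<open>Q\<close> and \<open>Q'\<close> are the lists of one pair of opposite vertices, \<open>R\<close> and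
  \<open>R'\<close> those of the other. Choosing on the first pair two colors that differ as a set from both other
  lists leaves a color for each of the remaining vertices.
\<close>

lemma square_colors:
  assumes Q: "2 \<le> card Q" "2 \<le> card Q'" and R: "2 \<le> card R" "2 \<le> card R'"
  shows "\<exists>a\<in>Q. \<exists>a'\<in>Q'. \<exists>b\<in>R. \<exists>b'\<in>R'. {a, a'} \<inter> {b, b'} = {}"
proof -
  have "\<exists>a\<in>Q. \<exists>a'\<in>Q'. (\<exists>b\<in>R. b \<notin> {a, a'}) \<and> (\<exists>b'\<in>R'. b' \<notin> {a, a'})"
  proof (cases "Q = Q'")
    case True
    obtain a where "a \<in> Q" using Q(1) by (metis card_ge2_obtain)
    moreover have "\<exists>b\<in>R. b \<notin> {a, a}" "\<exists>b'\<in>R'. b' \<notin> {a, a}"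
      using R ex_fresh_color[of "{a, a}" 1] by auto
    ultimately show ?thesis using True by metis
  next
    case False
    obtain R0 R0' where sub: "R0 \<subseteq> R" "card R0 = 2" "R0' \<subseteq> R'" "card R0' = 2"
      using R by (metis obtain_subset_with_card_n)
    obtain a a' where "a \<in> Q" "a' \<in> Q'" "{a, a'} \<noteq> R0" "{a, a'} \<noteq> R0'"
      using transversal_avoiding_two_pairs[OF Q, of R0 R0'] False by metis
    moreover have "\<exists>b\<in>R0. b \<notin> {a, a'}" "\<exists>b'\<in>R0'. b' \<notin> {a, a'}"
      using card_2_neq_pair[of _ a a'] sub calculation by metis+
    ultimately show ?thesis using sub by (metis subsetD)
  qed
  then obtain a a' b b' where "a \<in> Q" "a' \<in> Q'" "b \<in> R" "b' \<in> R'" "b \<notin> {a, a'}" "b' \<notin> {a, a'}"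
    by metis
  moreover from this have "{a, a'} \<inter> {b, b'} = {}" by auto
  ultimately show ?thesis by metis
qed

text \<open>
  The octahedron is the complete tripartite graph with parts of size two; \<open>P, P'\<close> are the lists of
  one part, and so on.
\<close>

definition octahedron_colors :: "'c set \<Rightarrow> 'c set \<Rightarrow> 'c set \<Rightarrow> 'c set \<Rightarrow> 'c set \<Rightarrow> 'c set \<Rightarrow> bool" where
  "octahedron_colors P P' Q Q' R R' \<longleftrightarrow>
     (\<exists>p\<in>P. \<exists>p'\<in>P'. \<exists>q\<in>Q. \<exists>q'\<in>Q'. \<exists>r\<in>R. \<exists>r'\<in>R'.
        {p, p'} \<inter> {q, q'} = {} \<and> {p, p'} \<inter> {r, r'} = {} \<and> {q, q'} \<inter> {r, r'} = {})"

lemma octahedron_colorsI: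
  assumes "p \<in> P" "p' \<in> P'" "q \<in> Q" "q' \<in> Q'" "r \<in> R" "r' \<in> R'"
    "{p, p'} \<inter> {q, q'} = {}" "{p, p'} \<inter> {r, r'} = {}" "{q, q'} \<inter> {r, r'} = {}"
  shows "octahedron_colors P P' Q Q' R R'"
  unfolding octahedron_colors_def using assms by metis

lemma octahedron_colors_rotate:
  assumes "octahedron_colors P P' Q Q' R R'" shows "octahedron_colors Q Q' R R' P P'"
proof -
  obtain p p' q q' r r' where *: "p \<in> P" "p' \<in> P'" "q \<in> Q" "q' \<in> Q'" "r \<in> R" "r' \<in> R'"
    "{p, p'} \<inter> {q, q'} = {}" "{p, p'} \<inter> {r, r'} = {}" "{q, q'} \<inter> {r, r'} = {}"
    using assms unfolding octahedron_colors_def by (elim bexE conjE)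
  then have "{q, q'} \<inter> {p, p'} = {}" "{r, r'} \<inter> {p, p'} = {}"
    by (simp_all only: Int_commute)
  with * show ?thesis
    by (intro octahedron_colorsI[of q _ q' _ r _ r' _ p _ p'])
qed

lemma octahedron_colors_first:
  assumes "p \<in> P" "p' \<in> P'" and Q: "2 \<le> card (Q - {p, p'})" "2 \<le> card (Q' - {p, p'})"
    and R: "2 \<le> card (R - {p, p'})" "2 \<le> card (R' - {p, p'})"
  shows "octahedron_colors P P' Q Q' R R'"
proof -
  obtain q q' r r' where *: "q \<in> Q - {p, p'}" "q' \<in> Q' - {p, p'}" "r \<in> R - {p, p'}" "r' \<in> R' - {p, p'}"
    "{q, q'} \<inter> {r, r'} = {}"
    using square_colors[OF Q R] by (elim bexE)
  then have "{p, p'} \<inter> {q, q'} = {}" "{p, p'} \<inter> {r, r'} = {}" by auto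
  moreover have "q \<in> Q" "q' \<in> Q'" "r \<in> R" "r' \<in> R'" using * by auto
  ultimately show ?thesis
    using *(5) assms(1,2) octahedron_colorsI by metis
qed

lemma card_Diff_pair_saving:
  assumes "p = p' \<or> p \<notin> X \<or> p' \<notin> X"
  shows "card X - 1 \<le> card (X - {p, p'})"
proof -
  have "X - {p, p'} = X - {p} \<or> X - {p, p'} = X - {p'}" using assms by auto
  moreover have "card X - 1 \<le> card (X - {u})" for u
    using diff_card_le_card_Diff[of "{u}" X] by simp
  ultimately show ?thesis by metis
qed

lemma octahedron_colors_common:
  assumes "c \<in> P \<inter> P'" "card Q = 3" "card Q' = 3" "card R = 3" "card R' = 3"
  shows "octahedron_colors P P' Q Q' R R'"
proof -
  have "2 \<le> card (X - {c, c})" if "card X = 3" for X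
    using diff_card_le_card_Diff[of "{c}" X] that by simp
  then show ?thesis using assms by (intro octahedron_colors_first[of c _ c]) auto
qed

text \<open>
  The octahedron is 3-choosable. A color shared by the two lists of a part is used for the whole part,
  and a 4-cycle with lists of size two remains. If the two lists in each part are disjoint, look for
  colors \<open>p \<in> P\<close> and \<open>p' \<in> P'\<close> that no further list contains both. A list \<open>X\<close> of size three
  excludes at most \<open>|P \<inter> X| * |P' \<inter> X| \<le> 2\<close> of the nine pairs, because \<open>|P \<inter> X| + |P' \<inter> X| \<le> 3\<close>; the
  four further lists exclude at most eight.
\<close>

lemma octahedron_colorable:
  assumes c: "card P = 3" "card P' = 3" "card Q = 3" "card Q' = 3" "card R = 3" "card R' = 3"
  shows "octahedron_colors P P' Q Q' R R'"
proof -
  consider c where "c \<in> P \<inter> P'" | c where "c \<in> Q \<inter> Q'" | c where "c \<in> R \<inter> R'"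
    | "P \<inter> P' = {}" "Q \<inter> Q' = {}" "R \<inter> R' = {}" by blast
  then show ?thesis
  proof cases
    case 1
    then show ?thesis using octahedron_colors_common c by metis
  next
    case 2
    then have "octahedron_colors Q Q' R R' P P'" using octahedron_colors_common c by metis
    then show ?thesis by (metis octahedron_colors_rotate)
  next
    case 3
    then have "octahedron_colors R R' P P' Q Q'" using octahedron_colors_common c by metis
    then show ?thesis by (metis octahedron_colors_rotate)
  next
    case 4
    define \<X> where "\<X> = {Q, Q', R, R'}"
    have fin: "finite P" "finite P'" "finite Q" "finite Q'" "finite R" "finite R'"
      using c by (auto intro: card_ge_0_finite)
    have X3: "card X = 3" if "X \<in> \<X>" for X using that c unfolding \<X>_def by auto
    have "\<exists>p\<in>P. \<exists>p'\<in>P'. \<forall>X\<in>\<X>. p \<notin> X \<or> p' \<notin> X"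
    proof (rule ccontr)
      assume "\<not> ?thesis"
      then have "P \<times> P' \<subseteq> (\<Union>X\<in>\<X>. (P \<inter> X) \<times> (P' \<inter> X))" by blast
      then have "card (P \<times> P') \<le> card (\<Union>X\<in>\<X>. (P \<inter> X) \<times> (P' \<inter> X))"
        using fin by (intro card_mono) (auto simp: \<X>_def)
      also have "\<dots> \<le> (\<Sum>X\<in>\<X>. card ((P \<inter> X) \<times> (P' \<inter> X)))"
        by (rule card_UN_le) (simp add: \<X>_def)
      also have "\<dots> \<le> card \<X> * 2"
      proof (rule sum_bounded_above[of \<X> _ "2::nat", simplified])
        fix X assume X: "X \<in> \<X>"
        have "card (P \<inter> X) + card (P' \<inter> X) = card ((P \<inter> X) \<union> (P' \<inter> X))"
          using fin 4 by (intro card_Un_disjoint[symmetric]) auto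
        also have "\<dots> \<le> 3"
          using X3[OF X] by (metis card_mono card_ge_0_finite zero_less_numeral Int_lower2 Un_least)
        finally have s: "card (P \<inter> X) + card (P' \<inter> X) \<le> 3" .
        then have "card (P \<inter> X) = 0 \<or> card (P \<inter> X) = 1 \<or> card (P \<inter> X) = 2 \<or> card (P \<inter> X) = 3"
          by linarith
        with s show "card ((P \<inter> X) \<times> (P' \<inter> X)) \<le> 2"
          by (elim disjE) (simp_all add: card_cartesian_product)
      qed
      also have "card \<X> \<le> 4" unfolding \<X>_def by (simp add: card_insert_if)
      finally show False using c by (simp add: card_cartesian_product)
    qed
    then obtain p p' where p: "p \<in> P" "p' \<in> P'" and np: "\<And>X. X \<in> \<X> \<Longrightarrow> p \<notin> X \<or> p' \<notin> X"
      by metis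
    have "2 \<le> card (X - {p, p'})" if X: "X \<in> \<X>" for X
      using card_Diff_pair_saving[of p p' X] np[OF X] X3[OF X] by auto
    then show ?thesis
      using p by (intro octahedron_colors_first[of p _ p']) (simp_all add: \<X>_def)
  qed
qed

text \<open>
  The complete graph on six vertices without the edge between the vertices of \<open>P\<close> and \<open>P'\<close>. Greedy
  coloring ending with \<open>X\<close> is one color short, which is gained by coloring \<open>P\<close> and \<open>P'\<close> first such that
  \<open>X\<close> loses only one color to them: as \<open>3 + 3 > 5\<close>, either \<open>P\<close> and \<open>P'\<close> share a color or one of them
  has a color outside \<open>X\<close>.
\<close>

lemma K6_minus_edge_colors:
  assumes P: "3 \<le> card P" "3 \<le> card P'" and X: "5 \<le> card X" "5 \<le> card Y" "5 \<le> card Z" "5 \<le> card W"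
  obtains p p' x y z w where "p \<in> P" "p' \<in> P'" "x \<in> X" "y \<in> Y" "z \<in> Z" "w \<in> W"
    "distinct [x, y, z, w]" "{p, p'} \<inter> {x, y, z, w} = {}"
proof -
  \<comment> \<open>Shrinking \<open>X\<close> to exactly five colors makes the count \<open>3 + 3 > 5\<close> applicable.\<close>
  obtain X0 where X0: "X0 \<subseteq> X" "card X0 = 5" using X(1) by (metis obtain_subset_with_card_n)
  have fin: "finite X0" "finite P" "finite P'" using X0 P by (auto intro: card_ge_0_finite)
  obtain p p' where p: "p \<in> P" "p' \<in> P'" and save: "p = p' \<or> p \<notin> X0 \<or> p' \<notin> X0"
  proof (cases "P \<inter> P' = {}")
    case True
    then have "card X0 < card (P \<union> P')" using fin P X0 by (simp add: card_Un_disjoint)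
    then obtain c where c: "c \<in> P \<union> P'" "c \<notin> X0" using fin by (metis fresh_color)
    obtain d where "d \<in> P" using P(1) by (rule card_ge3_obtain)
    moreover obtain d' where "d' \<in> P'" using P(2) by (rule card_ge3_obtain)
    ultimately show thesis using c that by (elim UnE) metis+
  qed (use that in auto)
  have X4: "4 \<le> card (X0 - {p, p'})"
    using card_Diff_pair_saving[OF save] X0 by simp
  obtain y where y: "y \<in> Y" "y \<notin> {p, p'}"
    using ex_fresh_color[OF card_small_insert_le(1), of p p' "Y"] X by auto
  obtain z where z: "z \<in> Z" "z \<notin> {p, p', y}"
    using ex_fresh_color[OF card_small_insert_le(2), of p p' y "Z"] X by auto
  obtain w where w: "w \<in> W" "w \<notin> {p, p', y, z}"
    using ex_fresh_color[OF card_small_insert_le(3), of p p' y z "W"] X by auto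
  obtain x where x: "x \<in> X0 - {p, p'}" "x \<notin> {y, z, w}"
    using ex_fresh_color[OF card_small_insert_le(2), of y z w "X0 - {p, p'}"] X4 by auto
  show thesis
    by (rule that[of p p' x y z w]) (use p x y z w X0(1) in auto)
qed

section \<open>Two adjacent stars\<close>

text \<open>
  In the last configuration an edge \<open>z\<close> has two further edges \<open>f\<close>, \<open>g\<close> at its end of degree three, whose
  mates, the other edges at their ends of degree two, are \<open>F\<close>, \<open>G\<close>. Among these five edges only \<open>F\<close> and \<open>G\<close> do not conflict; the mate of \<open>z\<close> conflicts
  with \<open>z\<close>, \<open>f\<close>, \<open>g\<close>, but not with \<open>F\<close>, \<open>G\<close>. The predicate says that \<open>F\<close>, \<open>G\<close>, \<open>f\<close>, \<open>g\<close> can be colored from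
  their lists when \<open>z\<close> has color \<open>\<alpha>\<close> and its mate has color \<open>\<beta>\<close>.
\<close>

definition completes_star :: "'c set \<Rightarrow> 'c set \<Rightarrow> 'c set \<Rightarrow> 'c set \<Rightarrow> 'c \<Rightarrow> 'c \<Rightarrow> bool" where
  "completes_star LF LG Lf Lg \<alpha> \<beta> \<longleftrightarrow>
     (\<exists>s\<in>LF - {\<alpha>}. \<exists>t\<in>LG - {\<alpha>}. \<exists>p\<in>Lf - {\<alpha>, \<beta>}. \<exists>q\<in>Lg - {\<alpha>, \<beta>}.
        p \<noteq> q \<and> s \<notin> {p, q} \<and> t \<notin> {p, q})"

lemma pair_subset_if_card_Diff:
  assumes "card X = 4" "card (X - {a, b}) = 2" "a \<noteq> b"
  shows "{a, b} \<subseteq> X"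
proof -
  have "card (X - {a, b}) = card X - card (X \<inter> {a, b})"
    by (rule card_Diff_subset_Int) simp
  then have "card (X \<inter> {a, b}) = card {a, b}" using assms by simp
  then have "X \<inter> {a, b} = {a, b}" by (intro card_subset_eq) auto
  then show ?thesis by blast
qed

text \<open>
  With \<open>\<alpha>\<close> outside \<open>LF\<close> and \<open>LG\<close>, the edges \<open>F\<close> and \<open>G\<close> keep both colors, so it suffices that \<open>f\<close> and \<open>g\<close>
  receive two colors that form neither the set \<open>LF\<close> nor the set \<open>LG\<close>. By the lemma on transversals
  this is impossible only if what is left of \<open>Lf\<close> and \<open>Lg\<close> is the same pair \<open>LF\<close> or \<open>LG\<close>.
\<close>

lemma completes_star_fail:
  assumes F: "card LF = 2" and G: "card LG = 2" and f: "card Lf = 4" and g: "card Lg = 4"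
    and \<alpha>: "\<alpha> \<notin> LF \<union> LG" and neq: "\<alpha> \<noteq> \<beta>" and fail: "\<not> completes_star LF LG Lf Lg \<alpha> \<beta>"
  shows "Lf = Lg \<and> \<alpha> \<in> Lf \<and> (Lf - LF = {\<alpha>, \<beta>} \<or> Lf - LG = {\<alpha>, \<beta>})"
proof -
  have A: "2 \<le> card (Lf - {\<alpha>, \<beta>})"
    using diff_card_le_card_Diff[of "{\<alpha>, \<beta>}" Lf] neq f by simp
  have B: "2 \<le> card (Lg - {\<alpha>, \<beta>})"
    using diff_card_le_card_Diff[of "{\<alpha>, \<beta>}" Lg] neq g by simp
  have *: "Lf - {\<alpha>, \<beta>} = Lg - {\<alpha>, \<beta>} \<and> (Lf - {\<alpha>, \<beta>} = LF \<or> Lf - {\<alpha>, \<beta>} = LG)"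
  proof (rule ccontr)
    assume "\<not> ?thesis"
    from transversal_avoiding_two_pairs[OF A B this]
    obtain p q where pq: "p \<in> Lf - {\<alpha>, \<beta>}" "q \<in> Lg - {\<alpha>, \<beta>}" "p \<noteq> q"
      and "{p, q} \<noteq> LF" "{p, q} \<noteq> LG"
      by (elim bexE conjE)
    with card_2_neq_pair[OF F] card_2_neq_pair[OF G]
    obtain s t where "s \<in> LF" "s \<notin> {p, q}" "t \<in> LG" "t \<notin> {p, q}"
      by metis
    then show False
      using fail pq \<alpha> unfolding completes_star_def by blast
  qed
  then have "card (Lf - {\<alpha>, \<beta>}) = 2" "card (Lg - {\<alpha>, \<beta>}) = 2"
    using F G by metis+
  then have sub: "{\<alpha>, \<beta>} \<subseteq> Lf" "{\<alpha>, \<beta>} \<subseteq> Lg"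
    using pair_subset_if_card_Diff f g neq by metis+
  have "Lf = Lg"
    using * sub by (metis Diff_partition)
  moreover have "Lf - LF = {\<alpha>, \<beta>} \<or> Lf - LG = {\<alpha>, \<beta>}"
    using * sub(1) by (metis double_diff order_refl)
  ultimately show ?thesis using sub(1) by simp
qed

text \<open>
  Read \<open>X\<close> as the list of \<open>z\<close> and \<open>R \<alpha> \<beta>\<close> as: the side of \<open>z\<close> can be completed when \<open>z\<close> and its mate get the
  colors \<open>\<alpha>\<close> and \<open>\<beta>\<close>. There are two colors for \<open>z\<close> (the set \<open>S\<close>) that fail only if the two colors form one
  particular pair \<open>P\<close>. If \<open>P = S\<close>, the mate of \<open>z\<close> might insist on a color from \<open>S\<close> as well, and then all
  choices fail; in this case two further colors for \<open>z\<close> work with every color in \<open>S\<close> for the mate.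
\<close>

definition flexible :: "'c set \<Rightarrow> ('c \<Rightarrow> 'c \<Rightarrow> bool) \<Rightarrow> bool" where
  "flexible X R \<longleftrightarrow> (\<exists>S P. S \<subseteq> X \<and> card S = 2 \<and>
     (\<forall>\<alpha>\<in>S. \<forall>\<beta>. \<alpha> \<noteq> \<beta> \<and> {\<alpha>, \<beta>} \<noteq> P \<longrightarrow> R \<alpha> \<beta>) \<and>
     (S = P \<longrightarrow> (\<exists>S'\<subseteq>X. card S' = 2 \<and> S' \<inter> S = {} \<and> (\<forall>\<alpha>\<in>S'. \<forall>\<beta>\<in>S. R \<alpha> \<beta>))))"

lemma transversal_disjoint_avoiding_pair:
  assumes "card A = 2" "card B = 2" "A \<inter> B = {}"
  shows "\<exists>x\<in>A. \<exists>y\<in>B. x \<noteq> y \<and> {x, y} \<noteq> P"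
  using transversal_avoiding_two_pairs[of A B P P] assms by fastforce

lemma flexible_alternative_colors:
  assumes S': "S' \<subseteq> X" "card S' = 2" "S' \<inter> S = {}" "\<forall>\<alpha>\<in>S'. \<forall>\<beta>\<in>S. R \<alpha> \<beta>"
    and S: "S \<subseteq> Y" "card S = 2" and Q: "\<forall>\<beta>\<in>S. \<forall>\<alpha>. \<beta> \<noteq> \<alpha> \<and> {\<beta>, \<alpha>} \<noteq> P \<longrightarrow> Q \<beta> \<alpha>"
  shows "\<exists>\<alpha>\<in>X. \<exists>\<beta>\<in>Y. \<alpha> \<noteq> \<beta> \<and> R \<alpha> \<beta> \<and> Q \<beta> \<alpha>"
proof -
  obtain \<beta> \<alpha> where "\<beta> \<in> S" "\<alpha> \<in> S'" "\<beta> \<noteq> \<alpha>" "{\<beta>, \<alpha>} \<noteq> P"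
    using transversal_disjoint_avoiding_pair[of S S' P] S' S by (auto simp: Int_commute)
  with S' S Q have "\<alpha> \<in> X" "\<beta> \<in> Y" "\<alpha> \<noteq> \<beta>" "R \<alpha> \<beta>" "Q \<beta> \<alpha>" by auto
  then show ?thesis by metis
qed

text \<open>
  If the two sides propose different sets \<open>S\<close> and \<open>T\<close>, there are three candidate pairs of colors against
  two forbidden ones. If \<open>S = T\<close> and the only candidate is forbidden by one side, that side has its
  alternative set of colors, which leaves the other side several pairs and at most one of them forbidden.
\<close>

lemma flexible_compatible:
  assumes "flexible X R" and "flexible Y Q"
  shows "\<exists>\<alpha>\<in>X. \<exists>\<beta>\<in>Y. \<alpha> \<noteq> \<beta> \<and> R \<alpha> \<beta> \<and> Q \<beta> \<alpha>"
proof -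
  obtain S P where S: "S \<subseteq> X" "card S = 2"
    and R: "\<forall>\<alpha>\<in>S. \<forall>\<beta>. \<alpha> \<noteq> \<beta> \<and> {\<alpha>, \<beta>} \<noteq> P \<longrightarrow> R \<alpha> \<beta>"
    and S': "S = P \<longrightarrow> (\<exists>S'\<subseteq>X. card S' = 2 \<and> S' \<inter> S = {} \<and> (\<forall>\<alpha>\<in>S'. \<forall>\<beta>\<in>S. R \<alpha> \<beta>))"
    using assms(1) unfolding flexible_def by (elim exE conjE)
  obtain T P' where T: "T \<subseteq> Y" "card T = 2"
    and Q: "\<forall>\<beta>\<in>T. \<forall>\<alpha>. \<beta> \<noteq> \<alpha> \<and> {\<beta>, \<alpha>} \<noteq> P' \<longrightarrow> Q \<beta> \<alpha>"
    and T': "T = P' \<longrightarrow> (\<exists>S'\<subseteq>Y. card S' = 2 \<and> S' \<inter> T = {} \<and> (\<forall>\<beta>\<in>S'. \<forall>\<alpha>\<in>T. Q \<beta> \<alpha>))"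
    using assms(2) unfolding flexible_def by (elim exE conjE)
  consider "\<not> (S = T \<and> (S = P \<or> S = P'))" | "S = T" "S = P" | "S = T" "T = P'"
    by metis
  then show ?thesis
  proof cases
    case 1
    have "2 \<le> card S" "2 \<le> card T" using S T by simp_all
    from transversal_avoiding_two_pairs[OF this 1]
    obtain \<alpha> \<beta> where *: "\<alpha> \<in> S" "\<beta> \<in> T" "\<alpha> \<noteq> \<beta>" "{\<alpha>, \<beta>} \<noteq> P" "{\<alpha>, \<beta>} \<noteq> P'"
      by (elim bexE conjE)
    then have "{\<beta>, \<alpha>} \<noteq> P'" by (subst insert_commute)
    with * R Q have "R \<alpha> \<beta>" "Q \<beta> \<alpha>" by simp_all
    moreover have "\<alpha> \<in> X" "\<beta> \<in> Y" using S(1) T(1) *(1,2) by auto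
    ultimately show ?thesis using *(3) by metis
  next
    case 2
    obtain S' where "S' \<subseteq> X" "card S' = 2" "S' \<inter> S = {}" "\<forall>\<alpha>\<in>S'. \<forall>\<beta>\<in>S. R \<alpha> \<beta>"
      using S' 2 by metis
    from flexible_alternative_colors[OF this, of Y P' Q] T Q 2 show ?thesis by metis
  next
    case 3
    obtain S' where "S' \<subseteq> Y" "card S' = 2" "S' \<inter> T = {}" "\<forall>\<alpha>\<in>S'. \<forall>\<beta>\<in>T. Q \<alpha> \<beta>"
      using T' 3 by metis
    from flexible_alternative_colors[OF this, of X P R] S R 3 show ?thesis by metis
  qed
qed

lemma two_subset_avoiding:
  assumes "3 \<le> card A" obtains S where "S \<subseteq> A" "card S = 2" "S \<noteq> P"
proof -
  obtain a b c where *: "a \<in> A" "b \<in> A" "c \<in> A" "a \<noteq> b" "a \<noteq> c" "b \<noteq> c"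
    using assms by (rule card_ge3_obtain)
  then have "{a, b} \<noteq> {a, c}" by (auto simp: doubleton_eq_iff)
  then have "{a, b} \<noteq> P \<or> {a, c} \<noteq> P" by metis
  with * that[of "{a, b}"] that[of "{a, c}"] show ?thesis by auto
qed

lemma completes_starI:
  assumes "s \<in> LF" "s \<noteq> \<alpha>" "t \<in> LG" "t \<noteq> \<alpha>" "p \<in> Lf" "p \<notin> {\<alpha>, \<beta>}"
    "q \<in> Lg" "q \<notin> {\<alpha>, \<beta>}" "p \<noteq> q" "s \<notin> {p, q}" "t \<notin> {p, q}"
  shows "completes_star LF LG Lf Lg \<alpha> \<beta>"
  using assms unfolding completes_star_def by blast

lemma completes_star_commute: "completes_star LF LG Lf Lg = completes_star LG LF Lf Lg"
  unfolding completes_star_def by (intro ext) blast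

text \<open>
  The alternative colors: if \<open>Lf = Lg\<close> consists of \<open>LF\<close> and two more colors outside \<open>LG\<close>, then \<open>z\<close> may take
  a color from \<open>LG\<close> and its mate one of the two more colors. Then \<open>F\<close>, \<open>f\<close> share out \<open>LF\<close>, the edge \<open>g\<close>
  takes the other one of the two colors, and \<open>G\<close> takes the other color of \<open>LG\<close>.
\<close>

lemma completes_star_with_mate_in_rest:
  assumes F: "card LF = 2" and G: "card LG = 2" and disj: "LF \<inter> LG = {}" and f: "card Lf = 4"
    and diff: "Lf - LF = Lf - (LF \<union> LG)" and c: "card (Lf - (LF \<union> LG)) = 2"
    and \<alpha>: "\<alpha> \<in> LG" and \<beta>: "\<beta> \<in> Lf - (LF \<union> LG)"
  shows "completes_star LF LG Lf Lf \<alpha> \<beta>"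
proof -
  obtain p q where pq: "LF = {p, q}" "p \<noteq> q" using F by (auto simp: card_2_iff)
  have "LF \<subseteq> Lf"
    using pair_subset_if_card_Diff[OF f _ pq(2)] pq(1) diff c by metis
  then have pqf: "p \<in> Lf" "q \<in> Lf" using pq by auto
  have "card (Lf - (LF \<union> LG) - {\<beta>}) = 1" "card (LG - {\<alpha>}) = 1"
    using c G \<alpha> \<beta> by simp_all
  then obtain \<gamma> \<alpha>' where g: "\<gamma> \<in> Lf - (LF \<union> LG) - {\<beta>}" "\<alpha>' \<in> LG - {\<alpha>}"
    by (metis card_1_singletonE insertI1)
  have "LG \<inter> Lf = {}" using diff disj by blast
  then show ?thesis
    using g \<alpha> \<beta> pq pqf disj
    by (intro completes_starI[of p _ _ \<alpha>' _ q _ _ \<gamma>]) auto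
qed

text \<open>
  The colors for \<open>z\<close> come from \<open>Lz - U\<close> with \<open>U = LF \<union> LG\<close>, which has at least two elements, and at least
  three unless \<open>LF\<close> and \<open>LG\<close> are disjoint. By \<open>completes_star_fail\<close> a failing pair \<open>{\<alpha>, \<beta>}\<close> is \<open>Lf - LF\<close> or
  \<open>Lf - LG\<close>, hence contains \<open>Lf - U\<close>. If \<open>Lf - U\<close> has two elements, it is the only failing pair; if it
  has one, every failing pair has this one as its color of \<open>z\<close>, and either this color can be avoided or
  disjointness of \<open>LF\<close> and \<open>LG\<close> makes the failing pair unique.
\<close>

lemma completes_star_flexible:
  assumes F: "card LF = 2" and G: "card LG = 2" and f: "card Lf = 4" and g: "card Lg = 4"
    and z: "card Lz = 6"
  shows "flexible Lz (completes_star LF LG Lf Lg)" (is "flexible Lz ?R")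
proof -
  define U where "U = LF \<union> LG"
  have fin: "finite LF" "finite LG" "finite U" "finite Lz" "finite Lf"
    using F G f z unfolding U_def by (auto intro: card_ge_0_finite)
  have cU: "card U + card (LF \<inter> LG) = 4"
    using card_Un_Int[OF fin(1,2)] F G unfolding U_def by simp
  have S0: "card Lz - card U \<le> card (Lz - U)"
    using fin by (intro diff_card_le_card_Diff)
  have S02: "2 \<le> card (Lz - U)" using S0 cU z by simp
  have fail: "Lf = Lg \<and> \<alpha> \<in> Lf - U \<and> (Lf - LF = {\<alpha>, \<beta>} \<or> Lf - LG = {\<alpha>, \<beta>})"
    if "\<alpha> \<in> Lz - U" "\<alpha> \<noteq> \<beta>" "\<not> ?R \<alpha> \<beta>" for \<alpha> \<beta>
    using completes_star_fail[OF F G f g, of \<alpha> \<beta>] that unfolding U_def by blast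
  have generic: ?thesis
    if "S \<subseteq> Lz - U" "card S = 2" "S \<noteq> P"
      and generic_prem: "\<And>\<alpha> \<beta>. \<alpha> \<in> S \<Longrightarrow> \<alpha> \<noteq> \<beta> \<Longrightarrow> \<not> ?R \<alpha> \<beta> \<Longrightarrow> {\<alpha>, \<beta>} = P" for S P
    unfolding flexible_def
  proof (rule exI[of _ S], rule exI[of _ P], intro conjI ballI allI impI)
    show "S \<subseteq> Lz" using that(1) by auto
    show "card S = 2" by (rule that(2))
    show "?R \<alpha> \<beta>" if "\<alpha> \<in> S" "\<alpha> \<noteq> \<beta> \<and> {\<alpha>, \<beta>} \<noteq> P" for \<alpha> \<beta>
      using that generic_prem by metis
    show "\<exists>S'\<subseteq>Lz. card S' = 2 \<and> S' \<inter> S = {} \<and> (\<forall>\<alpha>\<in>S'. \<forall>\<beta>\<in>S. ?R \<alpha> \<beta>)" if "S = P"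
      using that \<open>S \<noteq> P\<close> by contradiction
  qed
  show ?thesis
  proof (cases "\<exists>\<alpha>\<in>Lz - U. \<exists>\<beta>. \<alpha> \<noteq> \<beta> \<and> \<not> ?R \<alpha> \<beta>")
    case False
    obtain S where "S \<subseteq> Lz - U" "card S = 2"
      using S02 by (rule obtain_subset_with_card_n)
    with False show ?thesis by (intro generic[of S "{}"]) auto
  next
    case True
    then obtain \<alpha>0 \<beta>0 where ab0: "\<alpha>0 \<in> Lz - U" "\<alpha>0 \<noteq> \<beta>0" "\<not> ?R \<alpha>0 \<beta>0" by auto
    note fail0 = fail[OF this]
    have P0: "{\<alpha>0, \<beta>0} = Lf - LF \<or> {\<alpha>0, \<beta>0} = Lf - LG" using fail0 by metis
    have cP0: "card {\<alpha>0, \<beta>0} = 2" using ab0 by simp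
    have UD: "Lf - U \<subseteq> Lf - LF" "Lf - U \<subseteq> Lf - LG" unfolding U_def by auto
    show ?thesis
    proof (cases "\<beta>0 \<in> Lf - U")
      case True
      have M: "2 \<le> card (Lf - U)"
        using cP0 fail0 True fin by (metis card_mono empty_subsetI finite_Diff insert_subset)
      have uniq: "{\<alpha>, \<beta>} = Lf - U" if "\<alpha> \<in> Lz - U" "\<alpha> \<noteq> \<beta>" "\<not> ?R \<alpha> \<beta>" for \<alpha> \<beta>
      proof -
        have c: "card {\<alpha>, \<beta>} = 2" using that by simp
        have "Lf - U \<subseteq> {\<alpha>, \<beta>}" using fail[OF that] UD by metis
        then show ?thesis using M c by (metis card_seteq finite.emptyI finite.insertI)
      qed
      note P = uniq[OF ab0]
      show ?thesis
      proof (cases "3 \<le> card (Lz - U)")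
        case True
        then obtain S where "S \<subseteq> Lz - U" "card S = 2" "S \<noteq> Lf - U" by (rule two_subset_avoiding)
        then show ?thesis by (intro generic[of S "Lf - U"] uniq) auto
      next
        case False
        then have c2: "card (Lz - U) = 2" using S02 by simp
        \<comment> \<open>Only when the single candidate \<open>Lz - U\<close> is the failing pair are the alternative colors needed.\<close>
        show ?thesis
        proof (cases "Lz - U = Lf - U")
          case False
          with c2 show ?thesis by (intro generic[of "Lz - U" "Lf - U"] uniq) auto
        next
          case S: True
          have "card U = 4" using c2 S0 z cU by simp
          then have disj: "LF \<inter> LG = {}" using cU fin by simp
          have "card (Lz \<inter> U) = card U"
            using card_Diff_subset_Int[of Lz U] fin c2 z \<open>card U = 4\<close> by simp
          then have UL: "U \<subseteq> Lz" using fin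
            by (metis card_subset_eq inf.absorb_iff2 inf_le2)
          have LfU: "card (Lf - U) = 2" using c2 S by simp
          have "\<exists>S'\<subseteq>Lz. card S' = 2 \<and> S' \<inter> (Lf - U) = {} \<and> (\<forall>\<alpha>\<in>S'. \<forall>\<beta>\<in>Lf - U. ?R \<alpha> \<beta>)"
          proof -
            consider "Lf - LF = Lf - U" | "Lf - LG = Lf - U" using P0 P by metis
            then show ?thesis
            proof cases
              case 1
              have "completes_star LF LG Lf Lf \<alpha> \<beta>" if "\<alpha> \<in> LG" "\<beta> \<in> Lf - U" for \<alpha> \<beta>
                using completes_star_with_mate_in_rest[OF F G disj f] 1 that LfU unfolding U_def by metis
              with fail0 G UL show ?thesis unfolding U_def by (intro exI[of _ LG]) auto
            next
              case 2
              have "completes_star LG LF Lf Lf \<alpha> \<beta>" if "\<alpha> \<in> LF" "\<beta> \<in> Lf - U" for \<alpha> \<beta>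
                using completes_star_with_mate_in_rest[OF G F _ f] disj 2 that LfU unfolding U_def
                by (metis Int_commute Un_commute)
              then have "?R \<alpha> \<beta>" if "\<alpha> \<in> LF" "\<beta> \<in> Lf - U" for \<alpha> \<beta>
                using fail0 that completes_star_commute by metis
              with F UL show ?thesis unfolding U_def by (intro exI[of _ LF]) auto
            qed
          qed
          then show ?thesis
            unfolding flexible_def using S uniq UL LfU
            by (intro exI[of _ "Lf - U"]) (metis Diff_subset)
        qed
      qed
    next
      case False
      then have "\<beta>0 \<in> U" using P0 by auto
      have "Lf - U \<subseteq> {\<alpha>0, \<beta>0}" using P0 UD by metis
      with \<open>\<beta>0 \<in> U\<close> have "Lf - U \<subseteq> {\<alpha>0}" by auto
      then have only: "\<alpha> = \<alpha>0" if "\<alpha> \<in> Lz - U" "\<alpha> \<noteq> \<beta>" "\<not> ?R \<alpha> \<beta>" for \<alpha> \<beta>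
        using fail[OF that] by (metis singletonD subsetD)
      show ?thesis
      proof (cases "3 \<le> card (Lz - U)")
        case True
        then have "2 \<le> card (Lz - U - {\<alpha>0})"
          using diff_card_le_card_Diff[of "{\<alpha>0}" "Lz - U"] by simp
        then obtain S where S: "S \<subseteq> Lz - U - {\<alpha>0}" "card S = 2"
          by (rule obtain_subset_with_card_n)
        show ?thesis
        proof (rule generic[of S "{}"])
          show "S \<subseteq> Lz - U" "S \<noteq> {}" using S by auto
          show "{\<alpha>, \<beta>} = {}" if "\<alpha> \<in> S" "\<alpha> \<noteq> \<beta>" "\<not> ?R \<alpha> \<beta>" for \<alpha> \<beta>
            using only[of \<alpha> \<beta>] that S by blast
        qed (rule S(2))
      next
        case False
        then have c2: "card (Lz - U) = 2" using S02 by simp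
        then have "card U = 4" using S0 z cU by simp
        then have disj: "LF \<inter> LG = {}" using cU fin by simp
        show ?thesis
        proof (rule generic[of "Lz - U" "{\<alpha>0, \<beta>0}"])
          show "Lz - U \<noteq> {\<alpha>0, \<beta>0}" using \<open>\<beta>0 \<in> U\<close> by blast
          show "{\<alpha>, \<beta>} = {\<alpha>0, \<beta>0}" if "\<alpha> \<in> Lz - U" "\<alpha> \<noteq> \<beta>" "\<not> ?R \<alpha> \<beta>" for \<alpha> \<beta>
          proof (rule ccontr)
            \<comment> \<open>Two failing pairs through \<open>\<alpha>0\<close> would cover \<open>Lf\<close> by three colors.\<close>
            assume ne: "{\<alpha>, \<beta>} \<noteq> {\<alpha>0, \<beta>0}"
            have "\<alpha> = \<alpha>0" using only[OF that] .
            have "(Lf - LF) \<union> (Lf - LG) = {\<alpha>, \<beta>} \<union> {\<alpha>0, \<beta>0}"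
              using fail[OF that] P0 ne by (metis Un_commute)
            moreover have "(Lf - LF) \<union> (Lf - LG) = Lf" using disj by blast
            ultimately have "Lf = {\<alpha>0, \<beta>, \<beta>0}" using \<open>\<alpha> = \<alpha>0\<close> by auto
            then have "card Lf \<le> 3" by (simp add: card_insert_if)
            with f show False by simp
          qed
        qed (simp_all add: c2)
      qed
    qed
  qed
qed

section \<open>Growing extendable sets\<close>

text \<open>
  Conflicting means different and at distance at most two in the reflexive relation \<open>adj\<close>, that is,
  adjacent in the square of the line graph. Lists have exactly six colors.
\<close>

locale square_list_coloring =
  fixes E :: "'e set" and adj :: "'e \<Rightarrow> 'e \<Rightarrow> bool" and L :: "'e \<Rightarrow> 'c set"
  assumes finite_E: "finite E"
    and adj_refl: "adj x x"
    and adj_sym: "adj x y \<Longrightarrow> adj y x"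
    and card_L: "x \<in> E \<Longrightarrow> card (L x) = 6"
begin

definition conf :: "'e \<Rightarrow> 'e \<Rightarrow> bool" where
  "conf x y \<longleftrightarrow> x \<noteq> y \<and> (\<exists>z\<in>E. adj x z \<and> adj z y)"

definition nbr :: "'e \<Rightarrow> 'e set" where
  "nbr x = {y \<in> E. conf x y}"

definition colors_from :: "('e \<Rightarrow> 'c set) \<Rightarrow> 'e set \<Rightarrow> ('e \<Rightarrow> 'c) \<Rightarrow> bool" where
  "colors_from L' S c \<longleftrightarrow> (\<forall>x\<in>S. c x \<in> L' x) \<and> (\<forall>x\<in>S. \<forall>y\<in>S. conf x y \<longrightarrow> c x \<noteq> c y)"

definition colorable :: "'e set \<Rightarrow> bool" where
  "colorable S \<longleftrightarrow> (\<exists>c. colors_from L S c)"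

text \<open>
  Colors already given to \<open>S\<close> may change when \<open>T\<close> is added: growth only passes on the fact that the part
  reached so far can be colored.
\<close>

definition extendable :: "'e set \<Rightarrow> bool" where
  "extendable T \<longleftrightarrow> T \<subseteq> E \<and> (\<forall>S. S \<subseteq> E - T \<and> colorable S \<longrightarrow> colorable (S \<union> T))"

text \<open>
  Excludes isolated members in the midst of conflicts: such a member says nothing about its
  surroundings, and growth could stop at it.
\<close>

definition linked :: "'e set \<Rightarrow> bool" where
  "linked T \<longleftrightarrow> (\<forall>x\<in>T. nbr x \<noteq> {} \<longrightarrow> nbr x \<inter> T \<noteq> {})"

definition closed :: "'e set \<Rightarrow> bool" where
  "closed X \<longleftrightarrow> (\<forall>x\<in>X. nbr x \<subseteq> X)"

lemma conf_sym: "conf x y \<Longrightarrow> conf y x"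
  unfolding conf_def using adj_sym by blast

lemma conf_irrefl [simp]: "\<not> conf x x"
  by (simp add: conf_def)

lemma finite_nbr [simp]: "finite (nbr x)"
  using finite_E by (simp add: nbr_def)

lemma nbr_iff: "y \<in> nbr x \<longleftrightarrow> y \<in> E \<and> conf x y"
  by (simp add: nbr_def)

text \<open>
  However the outside of \<open>T\<close> is colored, an element of \<open>T\<close> keeps all of its six colors except for one per
  conflict outside \<open>T\<close>; so extendability is a question about lists on \<open>T\<close> only.
\<close>

lemma extendableI_residual:
  assumes T: "T \<subseteq> E"
    and res: "\<And>L'. (\<And>x. x \<in> T \<Longrightarrow> 6 \<le> card (L' x) + card (nbr x - T)) \<Longrightarrow> \<exists>c. colors_from L' T c"
  shows "extendable T"
  unfolding extendable_def
proof (intro conjI allI impI T)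
  fix S assume S: "S \<subseteq> E - T \<and> colorable S"
  then obtain c where c: "colors_from L S c" unfolding colorable_def by blast
  define L' where "L' x = L x - c ` (nbr x \<inter> S)" for x
  have "6 \<le> card (L' x) + card (nbr x - T)" if "x \<in> T" for x
  proof -
    have "card (c ` (nbr x \<inter> S)) \<le> card (nbr x \<inter> S)" by (rule card_image_le) simp
    also have "\<dots> \<le> card (nbr x - T)" using S by (intro card_mono) auto
    finally have "card (c ` (nbr x \<inter> S)) \<le> card (nbr x - T)" .
    moreover have "card (L x) - card (c ` (nbr x \<inter> S)) \<le> card (L' x)"
      unfolding L'_def by (intro diff_card_le_card_Diff) simp
    ultimately show ?thesis using card_L that T by fastforce
  qed
  then obtain d where d: "colors_from L' T d" using res by blast
  define e where "e x = (if x \<in> T then d x else c x)" for x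
  have cross: "c x \<noteq> d y" if "x \<in> S" "y \<in> T" "conf x y" for x y
  proof -
    have "x \<in> nbr y \<inter> S" using that S conf_sym by (auto simp: nbr_iff)
    moreover have "d y \<notin> c ` (nbr y \<inter> S)" using d that unfolding colors_from_def L'_def by blast
    ultimately show ?thesis by (metis imageI)
  qed
  have "colors_from L (S \<union> T) e"
    unfolding colors_from_def
  proof (intro conjI ballI impI)
    fix x assume "x \<in> S \<union> T"
    then show "e x \<in> L x"
      using c d unfolding e_def colors_from_def L'_def by auto
  next
    fix x y assume *: "x \<in> S \<union> T" "y \<in> S \<union> T" "conf x y"
    show "e x \<noteq> e y"
    proof (cases "x \<in> T"; cases "y \<in> T")
      assume "x \<in> T" "y \<in> T"
      then show ?thesis using d * unfolding e_def colors_from_def by simp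
    next
      assume "x \<in> T" "y \<notin> T"
      then show ?thesis using cross[of y x] conf_sym * unfolding e_def by auto
    next
      assume "x \<notin> T" "y \<in> T"
      then show ?thesis using cross[of x y] * unfolding e_def by auto
    next
      assume "x \<notin> T" "y \<notin> T"
      then show ?thesis using c * unfolding e_def colors_from_def by simp
    qed
  qed
  then show "colorable (S \<union> T)" unfolding colorable_def by blast
qed

lemma extendable_empty: "extendable {}"
  unfolding extendable_def by simp

lemma extendable_singleton:
  assumes "y \<in> E" "card (nbr y) \<le> 5"
  shows "extendable {y}"
proof (rule extendableI_residual)
  fix L' :: "'e \<Rightarrow> 'c set" assume *: "\<And>x. x \<in> {y} \<Longrightarrow> 6 \<le> card (L' x) + card (nbr x - {y})"
  have "card (nbr y - {y}) \<le> card (nbr y)" by (intro card_mono) auto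
  then have "card (L' y) \<noteq> 0" using *[of y] assms by simp
  then obtain a where "a \<in> L' y" by (metis card.empty equals0I)
  then have "colors_from L' {y} (\<lambda>_. a)" by (simp add: colors_from_def)
  then show "\<exists>c. colors_from L' {y} c" by blast
qed (use assms in simp)

lemma extendable_Un:
  assumes R: "extendable R" and T: "extendable T" and disj: "R \<inter> T = {}"
  shows "extendable (R \<union> T)"
  unfolding extendable_def
proof (intro conjI allI impI)
  show "R \<union> T \<subseteq> E" using R T unfolding extendable_def by simp
  fix S assume S: "S \<subseteq> E - (R \<union> T) \<and> colorable S"
  then have "S \<subseteq> E - R" by auto
  then have "colorable (S \<union> R)" using R S unfolding extendable_def by simp
  moreover have "S \<union> R \<subseteq> E - T" using S R disj unfolding extendable_def by auto
  ultimately have "colorable (S \<union> R \<union> T)" using T unfolding extendable_def by simp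
  then show "colorable (S \<union> (R \<union> T))" by (simp add: Un_assoc)
qed

text \<open>
  Color \<open>y\<close> before \<open>T\<close>: it sees at most five colors.
\<close>

lemma extendable_insert:
  assumes T: "extendable T" and y: "y \<in> E" "y \<notin> T" and few: "card (nbr y - T) \<le> 5"
  shows "extendable (insert y T)"
  unfolding extendable_def
proof (intro conjI allI impI)
  show "insert y T \<subseteq> E" using T y unfolding extendable_def by simp
  fix S assume S: "S \<subseteq> E - insert y T \<and> colorable S"
  then obtain c where c: "colors_from L S c" unfolding colorable_def by blast
  have "card (c ` (nbr y \<inter> S)) \<le> card (nbr y \<inter> S)" by (rule card_image_le) simp
  also have "\<dots> \<le> card (nbr y - T)" using S by (intro card_mono) auto
  finally have "card (c ` (nbr y \<inter> S)) < card (L y)" using few card_L[OF y(1)] by simp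
  then obtain a where a: "a \<in> L y" "a \<notin> c ` (nbr y \<inter> S)"
    using fresh_color[of "c ` (nbr y \<inter> S)"] by auto
  have new: "a \<noteq> c x" if "x \<in> S" "conf y x" for x
    using a(2) that S by (auto simp: nbr_iff)
  have "colors_from L (insert y S) (c(y := a))"
    using c a(1) S new conf_sym unfolding colors_from_def by auto
  then have "colorable (insert y S)" unfolding colorable_def by blast
  moreover have "insert y S \<subseteq> E - T" using S y by auto
  ultimately have "colorable (insert y S \<union> T)" using T unfolding extendable_def by blast
  then show "colorable (S \<union> insert y T)" by simp
qed

text \<open>
  This is where the conflict relation has to be a square. Two conflicting members of \<open>T\<close> yield two
  adjacent ones \<open>x\<close>, \<open>y\<close> because an intermediate element conflicts with both. Everything adjacent to \<open>x\<close>
  conflicts with \<open>x\<close> and \<open>y\<close>, hence is in \<open>T\<close>; everything at distance two from \<open>x\<close> conflicts with \<open>x\<close> and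
  with the element in between, hence is in \<open>T\<close>, too.
\<close>

lemma closed_if_saturated:
  assumes T: "T \<subseteq> E" "linked T"
    and sat: "\<And>u a b. u \<in> E \<Longrightarrow> a \<in> T \<Longrightarrow> b \<in> T \<Longrightarrow> a \<noteq> b \<Longrightarrow> conf u a \<Longrightarrow> conf u b \<Longrightarrow> u \<in> T"
  shows "closed T"
  unfolding closed_def
proof (intro ballI subsetI)
  fix x w assume x: "x \<in> T" and w: "w \<in> nbr x"
  then have xE: "x \<in> E" and wE: "w \<in> E" and xw: "conf x w" using T by (auto simp: nbr_iff)
  have confI: "conf u v" if "u \<noteq> v" "adj u t" "adj t v" "t \<in> E" for u v t
    using that unfolding conf_def by blast
  have "nbr x \<inter> T \<noteq> {}" using T(2) x w unfolding linked_def by blast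
  then obtain y0 where y0: "y0 \<in> T" "conf x y0" by (auto simp: nbr_iff)
  obtain y where y: "y \<in> T" "y \<noteq> x" "adj x y"
  proof -
    obtain z where z: "z \<in> E" "adj x z" "adj z y0" using y0 unfolding conf_def by blast
    show thesis
    proof (cases "z = x \<or> z = y0")
      case True
      then have "adj x y0" using z by blast
      moreover have "y0 \<noteq> x" using y0(2) by auto
      ultimately show thesis using y0 that by blast
    next
      case False
      have "conf z x" using False z adj_sym adj_refl by (intro confI[of _ _ z]) auto
      moreover have "conf z y0" using False z adj_refl by (intro confI[of _ _ z]) auto
      moreover have "x \<noteq> y0" using y0(2) by auto
      ultimately have "z \<in> T" using sat[of z x y0] x y0 z by blast
      then show thesis using that z False by blast
    qed
  qed
  \<comment> \<open>Everything adjacent to \<open>x\<close> conflicts with both \<open>x\<close> and \<open>y\<close>.\<close>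
  have direct: "z \<in> T" if z: "z \<in> E" "adj x z" for z
  proof (cases "z = x \<or> z = y")
    case True
    then show ?thesis using x y by blast
  next
    case False
    have "conf z x" using False z adj_sym adj_refl by (intro confI[of _ _ z]) auto
    moreover have "conf z y" using False z y xE adj_sym by (intro confI[of _ _ x]) auto
    ultimately show ?thesis using sat[of z x y] x y z by blast
  qed
  obtain z where z: "z \<in> E" "adj x z" "adj z w" using xw unfolding conf_def by blast
  show "w \<in> T"
  proof (cases "z = w \<or> z = x")
    case True
    then show ?thesis using direct z wE by blast
  next
    case False
    have "z \<in> T" using direct z by blast
    moreover have "conf w z" using False z wE adj_sym adj_refl by (intro confI[of _ _ w]) auto
    moreover have "conf w x" using xw conf_sym by blast
    ultimately show ?thesis using sat[of w z x] x wE False by blast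
  qed
qed

lemma linked_Un: "linked R \<Longrightarrow> linked T \<Longrightarrow> linked (R \<union> T)"
  unfolding linked_def by blast

text \<open>
  Take a maximal linked extendable set \<open>R\<close>. An element outside with two conflicts in \<open>R\<close> has at most
  \<open>7 - 2 = 5\<close> outside and could be absorbed. So \<open>R\<close> is saturated, hence closed, and its complement is
  closed; a reducible part of the complement could be added to \<open>R\<close>.
\<close>

theorem colorable_if_reducible:
  assumes deg: "\<And>x. x \<in> E \<Longrightarrow> card (nbr x) \<le> 7"
    and red: "\<And>X. X \<subseteq> E \<Longrightarrow> X \<noteq> {} \<Longrightarrow> closed X \<Longrightarrow> \<exists>T\<subseteq>X. T \<noteq> {} \<and> extendable T \<and> linked T"
  shows "colorable E"
proof -
  define F where "F = {T. T \<subseteq> E \<and> extendable T \<and> linked T}"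
  have "finite F" unfolding F_def using finite_E by simp
  moreover have "{} \<in> F" unfolding F_def linked_def by (simp add: extendable_empty)
  ultimately obtain R where R: "R \<in> F" and max: "\<And>T. T \<in> F \<Longrightarrow> R \<subseteq> T \<Longrightarrow> T = R"
    using finite_has_maximal[of F] by blast
  have RE: "R \<subseteq> E" "extendable R" "linked R" using R unfolding F_def by auto
  have "closed R"
  proof (rule closed_if_saturated[OF RE(1,3)], rule ccontr)
    fix u a b assume *: "u \<in> E" "a \<in> R" "b \<in> R" "a \<noteq> b" "conf u a" "conf u b" and "u \<notin> R"
    have ab: "{a, b} \<subseteq> nbr u \<inter> R" using * RE by (auto simp: nbr_iff)
    then have "card {a, b} \<le> card (nbr u \<inter> R)" by (intro card_mono) auto
    then have "card (nbr u - R) \<le> 5"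
      using deg[OF *(1)] *(4) card_Diff_subset_Int[of "nbr u" R] by simp
    then have "extendable (insert u R)" using RE * \<open>u \<notin> R\<close> by (intro extendable_insert)
    moreover have "linked (insert u R)" using RE(3) ab unfolding linked_def by blast
    ultimately have "insert u R \<in> F" using RE * unfolding F_def by simp
    then show False using max \<open>u \<notin> R\<close> by blast
  qed
  then have cl: "closed (E - R)"
    unfolding closed_def using conf_sym by (fastforce simp: nbr_iff)
  have "E - R = {}"
  proof (rule ccontr)
    assume "E - R \<noteq> {}"
    then obtain T where T: "T \<subseteq> E - R" "T \<noteq> {}" "extendable T" "linked T"
      using red[of "E - R"] cl by blast
    then have "extendable (R \<union> T)" using RE by (intro extendable_Un) auto
    then have "R \<union> T \<in> F" using T RE linked_Un unfolding F_def by auto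
    then show False using max T by blast
  qed
  then have "E = R" using RE by blast
  then have "colorable ({} \<union> E)" using RE(2) unfolding extendable_def
    by (metis Diff_empty Diff_cancel colorable_def colors_from_def empty_iff empty_subsetI)
  then show ?thesis by simp
qed

end

section \<open>Conflicts of an edge and vertices of low degree\<close>

text \<open>
  A graph with bipartition \<open>A\<close>, \<open>B\<close> is described by its edges and the maps \<open>\<alpha>\<close> and \<open>\<beta>\<close> that send an edge
  to its end in \<open>A\<close> and in \<open>B\<close>.
\<close>

locale two_three_incidences =
  fixes E :: "'e set" and \<alpha> :: "'e \<Rightarrow> 'v" and \<beta> :: "'e \<Rightarrow> 'w" and L :: "'e \<Rightarrow> 'c set"
  assumes finite_edges: "finite E"
    and simple: "x \<in> E \<Longrightarrow> y \<in> E \<Longrightarrow> \<alpha> x = \<alpha> y \<Longrightarrow> \<beta> x = \<beta> y \<Longrightarrow> x = y"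
    and deg_\<alpha>: "x \<in> E \<Longrightarrow> card {y \<in> E. \<alpha> y = \<alpha> x} \<le> 2"
    and deg_\<beta>: "x \<in> E \<Longrightarrow> card {y \<in> E. \<beta> y = \<beta> x} \<le> 3"
    and six: "x \<in> E \<Longrightarrow> card (L x) = 6"
begin

definition adj :: "'e \<Rightarrow> 'e \<Rightarrow> bool" where
  "adj x y \<longleftrightarrow> \<alpha> x = \<alpha> y \<or> \<beta> x = \<beta> y"

sublocale square_list_coloring E adj L
  by unfold_locales (auto simp: adj_def finite_edges six)

definition mates :: "'e \<Rightarrow> 'e set" where
  "mates x = {y \<in> E. y \<noteq> x \<and> \<alpha> y = \<alpha> x}"

definition sibs :: "'e \<Rightarrow> 'e set" where
  "sibs x = {y \<in> E. y \<noteq> x \<and> \<beta> y = \<beta> x}"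

lemma finite_mates [simp]: "finite (mates x)" and finite_sibs [simp]: "finite (sibs x)"
  using finite_edges by (simp_all add: mates_def sibs_def)

lemma card_mates: "x \<in> E \<Longrightarrow> card (mates x) \<le> 1"
proof -
  assume x: "x \<in> E"
  then have "{y \<in> E. \<alpha> y = \<alpha> x} = insert x (mates x)" by (auto simp: mates_def)
  then show ?thesis using deg_\<alpha>[OF x] finite_edges by (simp add: mates_def)
qed

lemma card_sibs: "x \<in> E \<Longrightarrow> card (sibs x) \<le> 2"
proof -
  assume x: "x \<in> E"
  then have "{y \<in> E. \<beta> y = \<beta> x} = insert x (sibs x)" by (auto simp: sibs_def)
  then show ?thesis using deg_\<beta>[OF x] finite_edges by (simp add: sibs_def)
qed

lemma nbr_subset:
  "nbr x \<subseteq> mates x \<union> sibs x \<union> (\<Union>y\<in>mates x. sibs y) \<union> (\<Union>y\<in>sibs x. mates y)"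
proof
  fix y assume "y \<in> nbr x"
  then obtain z where y: "y \<in> E" "y \<noteq> x" "z \<in> E" "adj x z" "adj z y"
    by (auto simp: nbr_iff conf_def)
  show "y \<in> mates x \<union> sibs x \<union> (\<Union>y\<in>mates x. sibs y) \<union> (\<Union>y\<in>sibs x. mates y)"
  proof (cases "z = x \<or> z = y")
    case True
    then show ?thesis using y by (auto simp: adj_def mates_def sibs_def)
  next
    case False
    from y(4,5) consider "\<alpha> x = \<alpha> y" | "\<beta> x = \<beta> y" | "\<alpha> x = \<alpha> z" "\<beta> z = \<beta> y" | "\<beta> x = \<beta> z" "\<alpha> z = \<alpha> y"
      unfolding adj_def by auto
    then show ?thesis
    proof cases
      case 3
      then have "z \<in> mates x" "y \<in> sibs z" using y False by (auto simp: mates_def sibs_def)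
      then show ?thesis by blast
    next
      case 4
      then have "z \<in> sibs x" "y \<in> mates z" using y False by (auto simp: mates_def sibs_def)
      then show ?thesis by blast
    qed (use y in \<open>auto simp: mates_def sibs_def\<close>)
  qed
qed

lemma card_nbr_le:
  "card (nbr x) \<le> card (mates x) + card (sibs x) + (\<Sum>y\<in>mates x. card (sibs y)) + (\<Sum>y\<in>sibs x. card (mates y))"
proof -
  have "card (nbr x) \<le> card (mates x \<union> sibs x \<union> (\<Union>y\<in>mates x. sibs y) \<union> (\<Union>y\<in>sibs x. mates y))"
    using nbr_subset by (intro card_mono) auto
  also have "\<dots> \<le> card (mates x \<union> sibs x) + card (\<Union>y\<in>mates x. sibs y) + card (\<Union>y\<in>sibs x. mates y)"
    by (meson add_le_mono1 card_Un_le le_trans)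
  also have "\<dots> \<le> card (mates x) + card (sibs x) + (\<Sum>y\<in>mates x. card (sibs y)) + (\<Sum>y\<in>sibs x. card (mates y))"
    by (intro add_mono card_Un_le card_UN_le) simp_all
  finally show ?thesis .
qed

lemma card_nbr_bound:
  assumes "card (mates x) \<le> m" "card (sibs x) \<le> s"
    and "\<And>y. y \<in> mates x \<Longrightarrow> card (sibs y) \<le> s'" "(\<Sum>y\<in>sibs x. card (mates y)) \<le> m'"
  shows "card (nbr x) \<le> m + s + m * s' + m'"
proof -
  have "(\<Sum>y\<in>mates x. card (sibs y)) \<le> card (mates x) * s'"
    using sum_bounded_above[of "mates x" "\<lambda>y. card (sibs y)" s'] assms(3) by simp
  also have "\<dots> \<le> m * s'" using assms(1) by simp
  finally show ?thesis using card_nbr_le[of x] assms by linarith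
qed

lemma sum_mates_sibs: "(\<Sum>y\<in>sibs x. card (mates y)) \<le> card (sibs x)"
  using sum_bounded_above[of "sibs x" "\<lambda>y. card (mates y)" 1] card_mates by (simp add: sibs_def)

lemma mates_in: "y \<in> mates x \<Longrightarrow> y \<in> E" and sibs_in: "y \<in> sibs x \<Longrightarrow> y \<in> E"
  by (simp_all add: mates_def sibs_def)

lemma card_nbr: "x \<in> E \<Longrightarrow> card (nbr x) \<le> 7"
  using card_nbr_bound[of x 1 2 2 2] card_mates card_sibs mates_in
    order_trans[OF sum_mates_sibs[of x] card_sibs[of x]] by simp

lemma extendable_pair:
  assumes "x \<in> E" "y \<in> E" "conf x y" "card (nbr x) \<le> 5" "card (nbr y) \<le> 6"
  shows "extendable {y, x} \<and> linked {y, x}"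
proof
  have "y \<noteq> x" using assms(3) by auto
  have x: "x \<in> nbr y" "y \<in> nbr x" using assms conf_sym by (auto simp: nbr_iff)
  then have "card (nbr y - {x}) \<le> 5" using assms(5) by simp
  then show "extendable {y, x}"
    using assms \<open>y \<noteq> x\<close> by (intro extendable_insert extendable_singleton) auto
  show "linked {y, x}" using x unfolding linked_def by auto
qed

lemma mates_sym: "x \<in> E \<Longrightarrow> y \<in> mates x \<Longrightarrow> x \<in> mates y"
  by (auto simp: mates_def)

lemma sibs_sym: "x \<in> E \<Longrightarrow> y \<in> sibs x \<Longrightarrow> x \<in> sibs y"
  by (auto simp: sibs_def)

lemma mates_conf: "x \<in> E \<Longrightarrow> y \<in> mates x \<Longrightarrow> conf x y"
  unfolding mates_def conf_def adj_def by (auto intro!: bexI[of _ x])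

lemma sibs_conf: "x \<in> E \<Longrightarrow> y \<in> sibs x \<Longrightarrow> conf x y"
  unfolding sibs_def conf_def adj_def by (auto intro!: bexI[of _ x])

text \<open>
  An edge \<open>x\<close> with an end of less than full degree has at most five conflicts. Unless it has none at
  all, it has a mate or a sibling with at most six: color the latter first, then \<open>x\<close>.
\<close>

lemma low_degree_reducible:
  assumes x: "x \<in> E" and low: "mates x = {} \<or> card (sibs x) \<le> 1"
  shows "\<exists>T \<subseteq> insert x (nbr x). T \<noteq> {} \<and> extendable T \<and> linked T"
proof -
  consider "nbr x = {}" | y where "y \<in> mates x" "card (sibs x) \<le> 1" | y where "y \<in> sibs x" "mates x = {}"
    using low nbr_subset[of x] by (cases "mates x = {}"; cases "sibs x = {}") auto
  then show ?thesis
  proof cases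
    case 1
    then have "extendable {x}" "linked {x}" using x by (auto intro: extendable_singleton simp: linked_def)
    then show ?thesis by blast
  next
    case (2 y)
    have yE: "y \<in> E" using 2 mates_in by blast
    have "card (nbr x) \<le> 1 + 1 + 1 * 2 + 1"
      using card_mates card_sibs mates_in order_trans[OF sum_mates_sibs[of x] 2(2)] 2 x
      by (intro card_nbr_bound) simp_all
    moreover have "card (nbr y) \<le> 1 + 2 + 1 * 1 + 2"
    proof (intro card_nbr_bound)
      fix w assume "w \<in> mates y"
      moreover have "mates y = {x}"
        using card_mates[OF yE] mates_sym[OF x 2(1)]
        by (metis card_1_singleton_iff card_0_eq finite_mates le_antisym less_one linorder_not_le singletonD empty_iff One_nat_def)
      ultimately show "card (sibs w) \<le> 1" using 2 by simp
    qed (use card_mates card_sibs order_trans[OF sum_mates_sibs[of y] card_sibs[of y]] yE in simp_all)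
    ultimately have "extendable {y, x} \<and> linked {y, x}"
      using mates_conf x 2 yE by (intro extendable_pair) auto
    moreover have "y \<in> nbr x" using mates_conf x 2 yE by (simp add: nbr_iff)
    ultimately show ?thesis by (intro exI[of _ "{y, x}"]) auto
  next
    case (3 y)
    have yE: "y \<in> E" using 3 sibs_in by blast
    have "card (nbr x) \<le> 0 + 2 + 0 * 2 + 2"
      using card_sibs order_trans[OF sum_mates_sibs[of x] card_sibs[of x]] 3 x
      by (intro card_nbr_bound) simp_all
    moreover have "card (nbr y) \<le> 1 + 2 + 1 * 2 + 1"
    proof (intro card_nbr_bound)
      have xy: "x \<in> sibs y" using sibs_sym x 3 by blast
      have "(\<Sum>w\<in>sibs y. card (mates w)) = (\<Sum>w\<in>sibs y - {x}. card (mates w))"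
        using 3 xy by (intro sum.mono_neutral_right) auto
      also have "\<dots> \<le> of_nat (card (sibs y - {x})) * 1"
        by (rule sum_bounded_above) (metis DiffD1 card_mates sibs_in)
      also have "\<dots> \<le> 1" using xy card_sibs[OF yE] by simp
      finally show "(\<Sum>w\<in>sibs y. card (mates w)) \<le> 1" .
    qed (use card_mates card_sibs yE mates_in in auto)
    ultimately have "extendable {y, x} \<and> linked {y, x}"
      using sibs_conf x 3 yE by (intro extendable_pair) auto
    moreover have "y \<in> nbr x" using sibs_conf x 3 yE by (simp add: nbr_iff)
    ultimately show ?thesis by (intro exI[of _ "{y, x}"]) auto
  qed
qed

text \<open>
  With at most seven conflicts in all, \<open>k + 1\<close> conflicts inside \<open>T\<close> leave at most \<open>6 - k\<close> outside, and so
  at least \<open>k\<close> of six colors.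
\<close>

lemma residual_list_card:
  assumes "6 \<le> card A + card (nbr x - T)" "x \<in> E" "K \<subseteq> nbr x \<inter> T" "card K = Suc k"
  shows "k \<le> card A"
proof -
  have "card K \<le> card (nbr x \<inter> T)" using assms(3) by (intro card_mono) auto
  moreover have "card (nbr x - T) = card (nbr x) - card (nbr x \<inter> T)" by (simp add: card_Diff_subset_Int)
  moreover have "card (nbr x \<inter> T) \<le> card (nbr x)" by (intro card_mono) auto
  ultimately show ?thesis using assms(1,4) card_nbr[OF assms(2)] by linarith
qed

lemma colors_from_insert:
  "colors_from L' (insert u T) c \<longleftrightarrow>
     c u \<in> L' u \<and> (\<forall>v\<in>T. conf u v \<longrightarrow> c u \<noteq> c v) \<and> colors_from L' T c"
  unfolding colors_from_def using conf_sym by fastforce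

lemma colors_from_empty [simp]: "colors_from L' {} c"
  by (simp add: colors_from_def)

end

section \<open>Half-edges of a cubic multigraph\<close>

text \<open>
  If every edge in a union \<open>X\<close> of components has full degree at both ends, the vertices of degree two
  subdivide the edges of a cubic multigraph on the vertices of degree three. The edges in \<open>X\<close> are its
  half-edges, \<open>\<beta>\<close> is the vertex at which a half-edge starts, and \<open>mate\<close> is the other half.
\<close>

locale cubic_part = two_three_incidences E \<alpha> \<beta> L
  for E :: "'e set" and \<alpha> :: "'e \<Rightarrow> 'v" and \<beta> :: "'e \<Rightarrow> 'w" and L :: "'e \<Rightarrow> 'c set" +
  fixes X :: "'e set"
  assumes XE: "X \<subseteq> E" and closed_X: "closed X"
    and full: "x \<in> X \<Longrightarrow> card (mates x) = 1" "x \<in> X \<Longrightarrow> card (sibs x) = 2"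
begin

definition mate :: "'e \<Rightarrow> 'e" where
  "mate x = the_elem (mates x)"

lemma mates_eq: "x \<in> X \<Longrightarrow> mates x = {mate x}"
  using full(1) unfolding mate_def by (metis card_1_singletonE the_elem_eq)

lemma X_E: "x \<in> X \<Longrightarrow> x \<in> E"
  using XE by blast

lemma mate_X: "x \<in> X \<Longrightarrow> mate x \<in> X"
proof -
  assume x: "x \<in> X"
  then have "mate x \<in> mates x" using mates_eq by blast
  then have "mate x \<in> nbr x" using mates_conf mates_in x X_E by (simp add: nbr_iff)
  then show ?thesis using closed_X x unfolding closed_def by blast
qed

lemma sibs_X: "x \<in> X \<Longrightarrow> s \<in> sibs x \<Longrightarrow> s \<in> X"
proof -
  assume x: "x \<in> X" "s \<in> sibs x"
  then have "s \<in> nbr x" using sibs_conf sibs_in X_E by (simp add: nbr_iff)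
  then show ?thesis using closed_X x unfolding closed_def by blast
qed

lemma mate_props: 
  assumes "x \<in> X" shows "mate x \<noteq> x" "\<alpha> (mate x) = \<alpha> x" "mate x \<in> E"
  using mates_eq[OF assms] unfolding mates_def by auto

lemma mate_unique: "x \<in> X \<Longrightarrow> y \<in> E \<Longrightarrow> \<alpha> y = \<alpha> x \<Longrightarrow> y = x \<or> y = mate x"
  using mates_eq unfolding mates_def by blast

lemma mate_mate [simp]: "x \<in> X \<Longrightarrow> mate (mate x) = x"
  using mate_unique[of "mate x" x] mate_props mate_X X_E by metis

lemma \<beta>_mate: "x \<in> X \<Longrightarrow> \<beta> (mate x) \<noteq> \<beta> x"
  using simple[of "mate x" x] mate_props X_E by metis

lemma conf_iff:
  assumes x: "x \<in> X" and y: "y \<in> X"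
  shows "conf x y \<longleftrightarrow> x \<noteq> y \<and> (y = mate x \<or> \<beta> x = \<beta> y \<or> \<beta> (mate x) = \<beta> y \<or> \<beta> (mate y) = \<beta> x)"
proof
  assume "conf x y"
  then obtain z where *: "x \<noteq> y" "z \<in> E" "adj x z" "adj z y" unfolding conf_def by blast
  then consider "\<alpha> x = \<alpha> y" | "\<beta> x = \<beta> y" | "\<alpha> z = \<alpha> x" "\<beta> z = \<beta> y" | "\<alpha> z = \<alpha> y" "\<beta> x = \<beta> z"
    unfolding adj_def by metis
  then show "x \<noteq> y \<and> (y = mate x \<or> \<beta> x = \<beta> y \<or> \<beta> (mate x) = \<beta> y \<or> \<beta> (mate y) = \<beta> x)"
  proof cases
    case 1
    then show ?thesis using * mate_unique[OF x X_E[OF y]] by auto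
  next
    case 3
    then show ?thesis using * mate_unique[OF x] by auto
  next
    case 4
    then show ?thesis using * mate_unique[OF y] by auto
  qed (use * in auto)
next
  assume *: "x \<noteq> y \<and> (y = mate x \<or> \<beta> x = \<beta> y \<or> \<beta> (mate x) = \<beta> y \<or> \<beta> (mate y) = \<beta> x)"
  then have "adj x x \<and> adj x y \<or> adj x (mate x) \<and> adj (mate x) y \<or> adj x (mate y) \<and> adj (mate y) y"
    using mate_props[OF x] mate_props[OF y] unfolding adj_def by auto
  then show "conf x y"
    using * mate_props(3)[OF x] mate_props(3)[OF y] X_E[OF x] unfolding conf_def by blast
qed

lemma obtain_sibs:
  assumes "x \<in> X"
  obtains s t where "sibs x = {s, t}" "s \<noteq> t" "s \<in> X" "t \<in> X" "s \<noteq> x" "t \<noteq> x" "\<beta> s = \<beta> x" "\<beta> t = \<beta> x"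
proof -
  obtain s t where st: "sibs x = {s, t}" "s \<noteq> t" using full(2)[OF assms] by (auto simp: card_2_iff)
  then have "s \<in> sibs x" "t \<in> sibs x" by auto
  then show thesis using that st sibs_X[OF assms] by (auto simp: sibs_def)
qed

lemma obtain_other_sib:
  assumes "x \<in> X" "s \<in> sibs x"
  obtains p where "sibs x = {s, p}" "p \<noteq> s" "p \<noteq> x" "p \<in> X" "\<beta> p = \<beta> x"
proof -
  obtain a b where ab: "sibs x = {a, b}" "a \<noteq> b" "a \<in> X" "b \<in> X" "a \<noteq> x" "b \<noteq> x" "\<beta> a = \<beta> x" "\<beta> b = \<beta> x"
    using obtain_sibs[OF assms(1)] .
  then consider "s = a" | "s = b" using assms(2) by auto
  then show thesis
  proof cases
    case 1
    show thesis by (rule that[of b]) (use 1 ab in simp_all)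
  next
    case 2
    show thesis by (rule that[of a]) (use 2 ab in \<open>simp_all add: insert_commute\<close>)
  qed
qed

lemma nbr_X: "x \<in> X \<Longrightarrow> y \<in> nbr x \<longleftrightarrow> y \<in> X \<and> conf x y"
  using closed_X XE unfolding closed_def nbr_def by blast

lemma linked_if_conf:
  assumes "\<And>x. x \<in> T \<Longrightarrow> \<exists>y\<in>T. conf x y" "T \<subseteq> E"
  shows "linked T"
  using assms unfolding linked_def by (fastforce simp: nbr_iff)

text \<open>
  A digon of the cubic multigraph, with half-edges \<open>x\<close>, \<open>x'\<close> at one vertex and \<open>y\<close>, \<open>y'\<close> at the other. Let
  \<open>p\<close> and \<open>q\<close> be the third half-edges at these vertices. All six conflict mutually, except possibly \<open>p\<close>
  and \<open>q\<close>; the four in the digon have at most one conflict elsewhere, with the mate of \<open>p\<close> or of \<open>q\<close>. If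
  \<open>p\<close> and \<open>q\<close> conflict, they are mates, three parallel edges form the whole component, and
  \<open>x\<close> has just five conflicts.
\<close>

lemma digon_reducible:
  assumes x: "x \<in> X" "x' \<in> X" "x \<noteq> x'" and same: "\<beta> x = \<beta> x'" "\<beta> (mate x) = \<beta> (mate x')"
  shows "\<exists>T\<subseteq>X. T \<noteq> {} \<and> extendable T \<and> linked T"
proof -
  define y y' where "y = mate x" and "y' = mate x'"
  have y: "y \<in> X" "y' \<in> X" "mate y = x" "mate y' = x'" "\<beta> y = \<beta> y'"
    using x same mate_X unfolding y_def y'_def by auto
  have yy': "y \<noteq> y'" using x y by metis
  have bxy: "\<beta> x \<noteq> \<beta> y" using \<beta>_mate[OF x(1)] unfolding y_def by simp
  have "x' \<in> sibs x" using x same X_E by (auto simp: sibs_def)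
  then obtain p where sp: "sibs x = {x', p}" and p: "p \<noteq> x'" "p \<noteq> x" "p \<in> X" "\<beta> p = \<beta> x"
    using obtain_other_sib[OF x(1)] by blast
  have "y' \<in> sibs y" using y yy' X_E by (auto simp: sibs_def)
  then obtain q where sq: "sibs y = {y', q}" and q: "q \<noteq> y'" "q \<noteq> y" "q \<in> X" "\<beta> q = \<beta> y"
    using obtain_other_sib[OF y(1)] by blast
  have clx: "u = x \<or> u = x' \<or> u = p" if "u \<in> X" "\<beta> u = \<beta> x" for u
    using sp that X_E unfolding sibs_def by blast
  have cly: "u = y \<or> u = y' \<or> u = q" if "u \<in> X" "\<beta> u = \<beta> y" for u
    using sq that X_E unfolding sibs_def by blast
  have d: "distinct [x, x', y, y', p, q]"
    using x y yy' bxy p q same by auto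
  have mx: "mate x = y" "mate x' = y'" unfolding y_def y'_def by auto
  have nb: "u \<in> {x, x', y, y', p, q, mate p}" if "u \<in> nbr v" "v \<in> {x, x'}" for u v
  proof -
    have v: "v \<in> X" "\<beta> v = \<beta> x" "\<beta> (mate v) = \<beta> y" using that x same mx y by auto
    then have u: "u \<in> X" "conf v u" using that nbr_X by auto
    then consider "u = mate v" | "\<beta> u = \<beta> x" | "\<beta> u = \<beta> y" | "\<beta> (mate u) = \<beta> x"
      using conf_iff[of v u] v by auto
    then show ?thesis
    proof cases
      case 4
      then have "mate u = x \<or> mate u = x' \<or> mate u = p" using clx mate_X u by blast
      then show ?thesis using mate_mate[OF u(1)] mx by auto
    qed (use that mx clx cly u in auto)
  qed
  have nb': "u \<in> {x, x', y, y', p, q, mate q}" if "u \<in> nbr v" "v \<in> {y, y'}" for u v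
  proof -
    have v: "v \<in> X" "\<beta> v = \<beta> y" "\<beta> (mate v) = \<beta> x" using that x same y by auto
    then have u: "u \<in> X" "conf v u" using that nbr_X by auto
    then consider "u = mate v" | "\<beta> u = \<beta> y" | "\<beta> u = \<beta> x" | "\<beta> (mate u) = \<beta> y"
      using conf_iff[of v u] v by auto
    then show ?thesis
    proof cases
      case 4
      then have "mate u = y \<or> mate u = y' \<or> mate u = q" using cly mate_X u by blast
      then show ?thesis using mate_mate[OF u(1)] y(3,4) by auto
    qed (use that clx cly u y(3,4) in auto)
  qed
  have cf: "conf u v" if "u \<in> {x, x'}" "v \<in> {x, x', y, y', p, q}" "u \<noteq> v" for u v
    using that x y(1,2,5) p q same mx by (subst conf_iff) auto
  have cf': "conf u v" if "u \<in> {y, y'}" "v \<in> {x, x', y, y', p, q}" "u \<noteq> v" for u v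
    using that x y p q same by (subst conf_iff) auto
  define T where "T = {x, x', y, y', p, q}"
  have TX: "T \<subseteq> X" unfolding T_def using x y p q by auto
  show ?thesis
  proof (cases "conf p q")
    case True
    then consider "q = mate p" | "\<beta> (mate p) = \<beta> y" | "\<beta> (mate q) = \<beta> x"
      using conf_iff[of p q] p q bxy by auto
    then have "mate p = q"
    proof cases
      case 2
      then have "mate p = y \<or> mate p = y' \<or> mate p = q" using cly[of "mate p"] mate_X p by blast
      moreover have "mate p \<noteq> y" "mate p \<noteq> y'" using mate_mate[of p] y(3,4) p by metis+
      ultimately show ?thesis by blast
    next
      case 3
      then have "mate q = x \<or> mate q = x' \<or> mate q = p" using clx[of "mate q"] mate_X q by blast
      moreover have "mate q \<noteq> x" "mate q \<noteq> x'" using mate_mate[of q] mx q by metis+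
      ultimately show ?thesis using mate_mate[of q] q by metis
    qed simp
    have "card (nbr v) \<le> 5" if "v \<in> {x, x'}" for v
    proof -
      have "nbr v \<subseteq> {x, x', y, y', p, q} - {v}"
      proof
        fix u assume u: "u \<in> nbr v"
        then have "u \<noteq> v" by (auto simp: nbr_iff)
        with nb[OF u that] show "u \<in> {x, x', y, y', p, q} - {v}"
          unfolding \<open>mate p = q\<close> by blast
      qed
      then have "card (nbr v) \<le> card ({x, x', y, y', p, q} - {v})" by (intro card_mono) auto
      also have "\<dots> = 5" using that d by auto
      finally show ?thesis .
    qed
    from this[of x] this[of x'] have "card (nbr x) \<le> 5" "card (nbr x') \<le> 6" by simp_all
    then have "extendable {x', x} \<and> linked {x', x}"
      using x X_E cf d by (intro extendable_pair) auto
    then show ?thesis using x by (intro exI[of _ "{x', x}"]) auto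
  next
    case False
    have "extendable T"
    proof (rule extendableI_residual)
      show "T \<subseteq> E" using TX XE by blast
      fix L' :: "'e \<Rightarrow> 'c set"
      assume res: "\<And>u. u \<in> T \<Longrightarrow> 6 \<le> card (L' u) + card (nbr u - T)"
      have five: "5 \<le> card (L' u)" if "u \<in> {x, x', y, y'}" for u
      proof -
        have "nbr u - T \<subseteq> {mate p} \<or> nbr u - T \<subseteq> {mate q}"
          using nb[of _ u] nb'[of _ u] that unfolding T_def by blast
        then have "card (nbr u - T) \<le> 1"
          using card_mono[of "{mate p}" "nbr u - T"] card_mono[of "{mate q}" "nbr u - T"] by auto
        then show ?thesis using res[of u] that unfolding T_def by auto
      qed
      have three: "3 \<le> card (L' u)" if "u \<in> {p, q}" for u
      proof (rule residual_list_card[of _ u T "{x, x', y, y'}"])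
        show "6 \<le> card (L' u) + card (nbr u - T)" using res that unfolding T_def by auto
        show "u \<in> E" using that p q X_E by auto
        show "{x, x', y, y'} \<subseteq> nbr u \<inter> T"
          using that cf[of _ u] cf'[of _ u] d conf_sym x y X_E unfolding T_def by (auto simp: nbr_iff)
        show "card {x, x', y, y'} = Suc 3" using d by simp
      qed
      obtain cp cq cx cx' cy cy' where c: "cp \<in> L' p" "cq \<in> L' q" "cx \<in> L' x" "cx' \<in> L' x'" "cy \<in> L' y" "cy' \<in> L' y'"
        "distinct [cx, cx', cy, cy']" "{cp, cq} \<inter> {cx, cx', cy, cy'} = {}"
        using K6_minus_edge_colors[of "L' p" "L' q" "L' x" "L' x'" "L' y" "L' y'"] three five
        by (metis insertI1 insertI2)
      define c where "c = (\<lambda>_. cq)(x := cx, x' := cx', y := cy, y' := cy', p := cp)"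
      have "colors_from L' T c"
        using c d False conf_sym unfolding T_def c_def colors_from_insert by auto
      then show "\<exists>c. colors_from L' T c" by blast
    qed
    moreover have "linked T"
    proof (rule linked_if_conf)
      show "T \<subseteq> E" using TX XE by blast
      show "\<exists>v\<in>T. conf u v" if "u \<in> T" for u
        using that cf[of x] cf[of x'] conf_sym d unfolding T_def by (cases "u = x") auto
    qed
    ultimately show ?thesis using TX unfolding T_def by blast
  qed
qed

text \<open>
  The form in which lists are bounded in an explicit configuration: \<open>vs\<close> enumerates conflicts of \<open>u\<close>.
\<close>

lemma residual_sublist:
  assumes "6 \<le> card A + card (nbr u - T)" "T \<subseteq> E" "u \<in> T"
    and vs: "set vs \<subseteq> T" "distinct vs" "length vs = Suc k" "list_all (conf u) vs"
  shows "\<exists>B\<subseteq>A. card B = k"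
proof -
  have "set vs \<subseteq> nbr u \<inter> T"
    using vs assms(2) by (auto simp: nbr_iff list_all_iff)
  moreover have "card (set vs) = Suc k" using vs by (simp add: distinct_card)
  ultimately have "k \<le> card A" using residual_list_card[OF assms(1)] assms(2,3) by blast
  then show ?thesis by (metis obtain_subset_with_card_n)
qed

text \<open>
  Among the six half-edges of a triangle \<open>uvw\<close>, the half of \<open>uv\<close> at \<open>u\<close> conflicts with all others except
  the half of \<open>vw\<close> at \<open>w\<close>. So the conflicts form an octahedron, and four conflicts inside leave a list of
  three.
\<close>

lemma triangle_reducible:
  assumes a: "a0 \<in> X" "a1 \<in> X" "a2 \<in> X"
    and tri: "\<beta> (mate a0) = \<beta> a1" "\<beta> (mate a1) = \<beta> a2" "\<beta> (mate a2) = \<beta> a0"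
    and ne: "mate a0 \<noteq> a1" "mate a1 \<noteq> a2" "mate a2 \<noteq> a0"
  shows "\<exists>T\<subseteq>X. T \<noteq> {} \<and> extendable T \<and> linked T"
proof -
  obtain b0 b1 b2 where b: "mate a0 = b0" "mate a1 = b1" "mate a2 = b2" by simp
  have bX: "b0 \<in> X" "b1 \<in> X" "b2 \<in> X" using mate_X[OF a(1)] mate_X[OF a(2)] mate_X[OF a(3)] b by simp_all
  have mb: "mate b0 = a0" "mate b1 = a1" "mate b2 = a2"
    using mate_mate[OF a(1)] mate_mate[OF a(2)] mate_mate[OF a(3)] b by simp_all
  have v: "\<beta> a0 \<noteq> \<beta> a1" "\<beta> a1 \<noteq> \<beta> a2" "\<beta> a2 \<noteq> \<beta> a0"
    using \<beta>_mate[OF a(1)] \<beta>_mate[OF a(2)] \<beta>_mate[OF a(3)] tri by simp_all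
  note bv = tri[unfolded b]
  have d: "distinct [a0, b0, a1, b1, a2, b2]"
    using v bv ne b by auto
  have conf: "conf a0 b0" "conf a0 a1" "conf a0 a2" "conf a0 b2" "conf b0 a1" "conf b0 b1" "conf b0 b2"
    "conf a1 b1" "conf a1 a2" "conf b1 a2" "conf b1 b2" "conf a2 b2"
    using d by (auto simp: conf_iff a bX b mb bv)
  have nonconf: "\<not> conf a0 b1" "\<not> conf a1 b2" "\<not> conf a2 b0"
    using d v by (auto simp: conf_iff a bX b mb bv)
  note conf' = conf[THEN conf_sym]
  define T where "T = {a0, b0, a1, b1, a2, b2}"
  have TX: "T \<subseteq> X" using a bX unfolding T_def by simp
  have "extendable T"
  proof (rule extendableI_residual)
    show "T \<subseteq> E" using TX XE by blast
    fix L' :: "'e \<Rightarrow> 'c set"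
    assume res: "\<And>u. u \<in> T \<Longrightarrow> 6 \<le> card (L' u) + card (nbr u - T)"
    have list: "\<exists>A\<subseteq>L' u. card A = k"
      if "u \<in> T" "set vs \<subseteq> T" "distinct vs" "length vs = Suc k" "list_all (conf u) vs" for u vs k
      using residual_sublist[OF res[OF that(1)] _ that] TX XE by blast
    have "\<exists>A\<subseteq>L' a0. card A = 3"
      by (rule list[of a0 "[b0, a1, a2, b2]"]) (use d in \<open>auto simp: T_def conf conf'\<close>)
    then obtain A0 where A0: "A0 \<subseteq> L' a0" "card A0 = 3" by blast
    have "\<exists>A\<subseteq>L' a1. card A = 3"
      by (rule list[of a1 "[b1, a0, a2, b0]"]) (use d in \<open>auto simp: T_def conf conf'\<close>)
    then obtain A1 where A1: "A1 \<subseteq> L' a1" "card A1 = 3" by blast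
    have "\<exists>A\<subseteq>L' a2. card A = 3"
      by (rule list[of a2 "[b2, a0, a1, b1]"]) (use d in \<open>auto simp: T_def conf conf'\<close>)
    then obtain A2 where A2: "A2 \<subseteq> L' a2" "card A2 = 3" by blast
    have "\<exists>A\<subseteq>L' b0. card A = 3"
      by (rule list[of b0 "[a0, a1, b1, b2]"]) (use d in \<open>auto simp: T_def conf conf'\<close>)
    then obtain B0 where B0: "B0 \<subseteq> L' b0" "card B0 = 3" by blast
    have "\<exists>A\<subseteq>L' b1. card A = 3"
      by (rule list[of b1 "[a1, b0, a2, b2]"]) (use d in \<open>auto simp: T_def conf conf'\<close>)
    then obtain B1 where B1: "B1 \<subseteq> L' b1" "card B1 = 3" by blast
    have "\<exists>A\<subseteq>L' b2. card A = 3"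
      by (rule list[of b2 "[a0, b0, b1, a2]"]) (use d in \<open>auto simp: T_def conf conf'\<close>)
    then obtain B2 where B2: "B2 \<subseteq> L' b2" "card B2 = 3" by blast
    obtain p p' q q' r r' where c: "p \<in> A0" "p' \<in> B1" "q \<in> A1" "q' \<in> B2" "r \<in> A2" "r' \<in> B0"
      "{p, p'} \<inter> {q, q'} = {}" "{p, p'} \<inter> {r, r'} = {}" "{q, q'} \<inter> {r, r'} = {}"
      using octahedron_colorable[OF A0(2) B1(2) A1(2) B2(2) A2(2) B0(2)]
      unfolding octahedron_colors_def by (elim bexE conjE)
    have cL: "p \<in> L' a0" "p' \<in> L' b1" "q \<in> L' a1" "q' \<in> L' b2" "r \<in> L' a2" "r' \<in> L' b0"
      using c A0(1) A1(1) A2(1) B0(1) B1(1) B2(1) by auto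
    have cd: "p \<noteq> q" "p \<noteq> q'" "p' \<noteq> q" "p' \<noteq> q'" "p \<noteq> r" "p \<noteq> r'" "p' \<noteq> r" "p' \<noteq> r'"
      "q \<noteq> r" "q \<noteq> r'" "q' \<noteq> r" "q' \<noteq> r'"
      using c(7-9) by auto
    define c where "c = (\<lambda>_. p)(b1 := p', a1 := q, b2 := q', a2 := r, b0 := r')"
    have cv: "c a0 = p" "c b1 = p'" "c a1 = q" "c b2 = q'" "c a2 = r" "c b0 = r'"
      using d unfolding c_def by auto
    have "colors_from L' T c"
      unfolding T_def colors_from_insert
      using cL cd cd[symmetric] nonconf conf_sym[of b0 a2] by (auto simp: cv)
    then show "\<exists>c. colors_from L' T c" by blast
  qed
  moreover have "linked T"
  proof (rule linked_if_conf)
    show "T \<subseteq> E" using TX XE by blast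
    show "\<exists>v\<in>T. conf u v" if "u \<in> T" for u
      using that conf conf' unfolding T_def by blast
  qed
  ultimately show ?thesis using TX unfolding T_def by blast
qed

text \<open>
  The half-edges of an edge \<open>zy\<close> of the cubic graph and of the four edges next to it. As the graph has
  neither digons nor triangles, the four far ends are distinct, so the conflicts are exactly those
  inside \<open>{F, G, f, g, z}\<close> except \<open>FG\<close>, those inside \<open>{y, h, i, H, I}\<close> except \<open>HI\<close>, and those between
  \<open>{z, f, g}\<close> and \<open>y\<close> or between \<open>z\<close> and \<open>{y, h, i}\<close>. The far halves
  \<open>F, G, H, I\<close> keep two colors, \<open>f, g, h, i\<close> keep four, and \<open>z\<close>, \<open>y\<close> keep six. Once \<open>z\<close> and \<open>y\<close> are colored,
  the two sides are independent; both sides being flexible, \<open>z\<close> and \<open>y\<close> have compatible colors.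
\<close>

lemma open_edge_reducible:
  assumes no_digon: "\<And>x x'. x \<in> X \<Longrightarrow> x' \<in> X \<Longrightarrow> x \<noteq> x' \<Longrightarrow> \<beta> x = \<beta> x' \<Longrightarrow> \<beta> (mate x) \<noteq> \<beta> (mate x')"
    and no_triangle: "\<And>a0 a1 a2. a0 \<in> X \<Longrightarrow> a1 \<in> X \<Longrightarrow> a2 \<in> X \<Longrightarrow>
      \<beta> (mate a0) = \<beta> a1 \<Longrightarrow> \<beta> (mate a1) = \<beta> a2 \<Longrightarrow> \<beta> (mate a2) = \<beta> a0 \<Longrightarrow>
      mate a0 \<noteq> a1 \<Longrightarrow> mate a1 \<noteq> a2 \<Longrightarrow> mate a2 \<noteq> a0 \<Longrightarrow> False"
    and z: "z \<in> X"
  shows "\<exists>T\<subseteq>X. T \<noteq> {} \<and> extendable T \<and> linked T"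
proof -
  obtain y where mz: "mate z = y" by simp
  have y: "y \<in> X" using mate_X[OF z] mz by simp
  have my: "mate y = z" using mate_mate[OF z] mz by simp
  have zy: "\<beta> z \<noteq> \<beta> y" using \<beta>_mate[OF z] mz by simp
  obtain f g where fg: "f \<noteq> g" "f \<in> X" "g \<in> X" "f \<noteq> z" "g \<noteq> z" "\<beta> f = \<beta> z" "\<beta> g = \<beta> z"
    using obtain_sibs[OF z] by metis
  obtain h i where hi: "h \<noteq> i" "h \<in> X" "i \<in> X" "h \<noteq> y" "i \<noteq> y" "\<beta> h = \<beta> y" "\<beta> i = \<beta> y"
    using obtain_sibs[OF y] by metis
  obtain F G H I where m: "mate f = F" "mate g = G" "mate h = H" "mate i = I" by simp
  have FX: "F \<in> X" "G \<in> X" "H \<in> X" "I \<in> X" using mate_X fg(2,3) hi(2,3) m by auto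
  have mF: "mate F = f" "mate G = g" "mate H = h" "mate I = i"
    using mate_mate fg(2,3) hi(2,3) m by auto
  have uF: "\<beta> F \<noteq> \<beta> z" "\<beta> G \<noteq> \<beta> z" "\<beta> F \<noteq> \<beta> y" "\<beta> G \<noteq> \<beta> y" "\<beta> F \<noteq> \<beta> G"
    using \<beta>_mate[OF fg(2)] \<beta>_mate[OF fg(3)] no_digon[OF fg(2) z] no_digon[OF fg(3) z]
      no_digon[OF fg(2,3,1)] fg m mz by simp_all
  have uH: "\<beta> H \<noteq> \<beta> z" "\<beta> I \<noteq> \<beta> z" "\<beta> H \<noteq> \<beta> y" "\<beta> I \<noteq> \<beta> y" "\<beta> H \<noteq> \<beta> I"
    using \<beta>_mate[OF hi(2)] \<beta>_mate[OF hi(3)] no_digon[OF hi(2) y] no_digon[OF hi(3) y]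
      no_digon[OF hi(2,3,1)] hi m my by simp_all
  \<comment> \<open>A common far end of an edge at \<open>z\<close> and an edge at \<open>y\<close> would close a triangle with the edge \<open>zy\<close>.\<close>
  have far: "\<beta> (mate s) \<noteq> \<beta> (mate t)"
    if "s \<in> X" "t \<in> X" "\<beta> s = \<beta> z" "\<beta> t = \<beta> y" "s \<noteq> z" "t \<noteq> y" for s t
  proof
    assume eq: "\<beta> (mate s) = \<beta> (mate t)"
    have "mate (mate t) = t" using mate_mate that by simp
    moreover have "mate s \<noteq> mate t" using mate_mate that zy by metis
    ultimately show False
      using no_triangle[of s "mate t" y] that y eq mate_X my by simp
  qed
  have uFH: "\<beta> F \<noteq> \<beta> H" "\<beta> F \<noteq> \<beta> I" "\<beta> G \<noteq> \<beta> H" "\<beta> G \<noteq> \<beta> I"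
    using far[of f h] far[of f i] far[of g h] far[of g i] fg hi m by simp_all
  note u = zy zy[symmetric] uF uF[symmetric] uH uH[symmetric] uFH uFH[symmetric]
  note bv = fg(6,7) hi(6,7)
  note mt = mz my m mF
  note inX = z y fg(2,3) hi(2,3) FX
  have d: "distinct [F, G, f, g, z, y, h, i, H, I]"
    using u bv fg(1,4,5) hi(1,4,5) by auto
  have conf: "conf F f" "conf F g" "conf F z" "conf G f" "conf G g" "conf G z"
    "conf f g" "conf f z" "conf g z" "conf f y" "conf g y" "conf z y"
    "conf z h" "conf z i" "conf h i" "conf y h" "conf y i"
    "conf y H" "conf y I" "conf h H" "conf h I" "conf i H" "conf i I"
    using d by (auto simp: conf_iff inX mt bv)
  have nonconf: "\<not> conf F G" "\<not> conf F y" "\<not> conf G y" "\<not> conf z H" "\<not> conf z I" "\<not> conf H I"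
    "\<not> conf F h" "\<not> conf F i" "\<not> conf F H" "\<not> conf F I" "\<not> conf G h" "\<not> conf G i" "\<not> conf G H" "\<not> conf G I"
    "\<not> conf f h" "\<not> conf f i" "\<not> conf f H" "\<not> conf f I" "\<not> conf g h" "\<not> conf g i" "\<not> conf g H" "\<not> conf g I"
    using d by (auto simp: conf_iff inX mt bv u)
  note conf' = conf[THEN conf_sym]
  define T where "T = {F, G, f, g, z, y, h, i, H, I}"
  have TX: "T \<subseteq> X" using inX unfolding T_def by simp
  have "extendable T"
  proof (rule extendableI_residual)
    show "T \<subseteq> E" using TX XE by blast
    fix L' :: "'e \<Rightarrow> 'c set"
    assume res: "\<And>u. u \<in> T \<Longrightarrow> 6 \<le> card (L' u) + card (nbr u - T)"
    have list: "\<exists>A\<subseteq>L' u. card A = k"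
      if "u \<in> T" "set vs \<subseteq> T" "distinct vs" "length vs = Suc k" "list_all (conf u) vs" for u vs k
      using residual_sublist[OF res[OF that(1)] _ that] TX XE by blast
    have "\<exists>A\<subseteq>L' F. card A = 2"
      by (rule list[of F "[f, g, z]"]) (use d in \<open>auto simp: T_def conf conf'\<close>)
    then obtain LF where LF: "LF \<subseteq> L' F" "card LF = 2" by blast
    have "\<exists>A\<subseteq>L' G. card A = 2"
      by (rule list[of G "[f, g, z]"]) (use d in \<open>auto simp: T_def conf conf'\<close>)
    then obtain LG where LG: "LG \<subseteq> L' G" "card LG = 2" by blast
    have "\<exists>A\<subseteq>L' H. card A = 2"
      by (rule list[of H "[h, i, y]"]) (use d in \<open>auto simp: T_def conf conf'\<close>)
    then obtain LH where LH: "LH \<subseteq> L' H" "card LH = 2" by blast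
    have "\<exists>A\<subseteq>L' I. card A = 2"
      by (rule list[of I "[h, i, y]"]) (use d in \<open>auto simp: T_def conf conf'\<close>)
    then obtain LI where LI: "LI \<subseteq> L' I" "card LI = 2" by blast
    have "\<exists>A\<subseteq>L' f. card A = 4"
      by (rule list[of f "[F, G, g, z, y]"]) (use d in \<open>auto simp: T_def conf conf'\<close>)
    then obtain Lf where Lf: "Lf \<subseteq> L' f" "card Lf = 4" by blast
    have "\<exists>A\<subseteq>L' g. card A = 4"
      by (rule list[of g "[F, G, f, z, y]"]) (use d in \<open>auto simp: T_def conf conf'\<close>)
    then obtain Lg where Lg: "Lg \<subseteq> L' g" "card Lg = 4" by blast
    have "\<exists>A\<subseteq>L' h. card A = 4"
      by (rule list[of h "[H, I, i, z, y]"]) (use d in \<open>auto simp: T_def conf conf'\<close>)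
    then obtain Lh where Lh: "Lh \<subseteq> L' h" "card Lh = 4" by blast
    have "\<exists>A\<subseteq>L' i. card A = 4"
      by (rule list[of i "[H, I, h, z, y]"]) (use d in \<open>auto simp: T_def conf conf'\<close>)
    then obtain Li where Li: "Li \<subseteq> L' i" "card Li = 4" by blast
    have "\<exists>A\<subseteq>L' z. card A = 6"
      by (rule list[of z "[F, G, f, g, y, h, i]"]) (use d in \<open>auto simp: T_def conf conf'\<close>)
    then obtain Lz where Lz: "Lz \<subseteq> L' z" "card Lz = 6" by blast
    have "\<exists>A\<subseteq>L' y. card A = 6"
      by (rule list[of y "[H, I, f, g, z, h, i]"]) (use d in \<open>auto simp: T_def conf conf'\<close>)
    then obtain Ly where Ly: "Ly \<subseteq> L' y" "card Ly = 6" by blast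
    obtain cz cy where c: "cz \<in> Lz" "cy \<in> Ly" "cz \<noteq> cy"
      and left: "completes_star LF LG Lf Lg cz cy" and right: "completes_star LH LI Lh Li cy cz"
      using flexible_compatible[OF completes_star_flexible[OF LF(2) LG(2) Lf(2) Lg(2) Lz(2)]
          completes_star_flexible[OF LH(2) LI(2) Lh(2) Li(2) Ly(2)]]
      by (elim bexE conjE)
    obtain cF cG cf cg where l: "cF \<in> LF - {cz}" "cG \<in> LG - {cz}" "cf \<in> Lf - {cz, cy}" "cg \<in> Lg - {cz, cy}"
        "cf \<noteq> cg" "cF \<notin> {cf, cg}" "cG \<notin> {cf, cg}"
      using left unfolding completes_star_def by (elim bexE conjE)
    obtain cH cI ch ci where r: "cH \<in> LH - {cy}" "cI \<in> LI - {cy}" "ch \<in> Lh - {cy, cz}" "ci \<in> Li - {cy, cz}"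
        "ch \<noteq> ci" "cH \<notin> {ch, ci}" "cI \<notin> {ch, ci}"
      using right unfolding completes_star_def by (elim bexE conjE)
    have cL: "cF \<in> L' F" "cG \<in> L' G" "cf \<in> L' f" "cg \<in> L' g" "cz \<in> L' z" "cy \<in> L' y"
      "ch \<in> L' h" "ci \<in> L' i" "cH \<in> L' H" "cI \<in> L' I"
      using l r c LF(1) LG(1) LH(1) LI(1) Lf(1) Lg(1) Lh(1) Li(1) Lz(1) Ly(1) by auto
    have cd: "cF \<noteq> cf" "cF \<noteq> cg" "cF \<noteq> cz" "cG \<noteq> cf" "cG \<noteq> cg" "cG \<noteq> cz" "cf \<noteq> cg" "cf \<noteq> cz" "cg \<noteq> cz"
      "cf \<noteq> cy" "cg \<noteq> cy" "cz \<noteq> cy" "cz \<noteq> ch" "cz \<noteq> ci" "ch \<noteq> ci" "cy \<noteq> ch" "cy \<noteq> ci" "cy \<noteq> cH" "cy \<noteq> cI"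
      "ch \<noteq> cH" "ch \<noteq> cI" "ci \<noteq> cH" "ci \<noteq> cI"
      using l r c by auto
    define c where "c = (\<lambda>_. cF)(G := cG, f := cf, g := cg, z := cz, y := cy, h := ch, i := ci, H := cH, I := cI)"
    have cv: "c F = cF" "c G = cG" "c f = cf" "c g = cg" "c z = cz" "c y = cy" "c h = ch" "c i = ci"
      "c H = cH" "c I = cI"
      using d unfolding c_def by auto
    have "colors_from L' T c"
      unfolding T_def colors_from_insert
      using cL cd nonconf by (simp add: cv)
    then show "\<exists>c. colors_from L' T c" by blast
  qed
  moreover have "linked T"
  proof (rule linked_if_conf)
    show "T \<subseteq> E" using TX XE by blast
    show "\<exists>v\<in>T. conf u v" if "u \<in> T" for u
      using that conf conf' unfolding T_def by blast
  qed
  ultimately show ?thesis using TX unfolding T_def by blast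
qed

lemma cubic_reducible:
  assumes "X \<noteq> {}"
  shows "\<exists>T\<subseteq>X. T \<noteq> {} \<and> extendable T \<and> linked T"
proof (rule ccontr)
  assume irreducible: "\<not> ?thesis"
  obtain z where "z \<in> X" using assms by blast
  have "?thesis"
  proof (rule open_edge_reducible[OF _ _ \<open>z \<in> X\<close>])
    show "\<beta> (mate x) \<noteq> \<beta> (mate x')" if "x \<in> X" "x' \<in> X" "x \<noteq> x'" "\<beta> x = \<beta> x'" for x x'
      using digon_reducible[OF that] irreducible by metis
    show False if "a0 \<in> X" "a1 \<in> X" "a2 \<in> X"
      "\<beta> (mate a0) = \<beta> a1" "\<beta> (mate a1) = \<beta> a2" "\<beta> (mate a2) = \<beta> a0"
      "mate a0 \<noteq> a1" "mate a1 \<noteq> a2" "mate a2 \<noteq> a0" for a0 a1 a2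
      using triangle_reducible[OF that] irreducible by metis
  qed
  with irreducible show False by contradiction
qed

end

context two_three_incidences begin

theorem colorable_edges: "colorable E"
proof (rule colorable_if_reducible)
  fix X assume X: "X \<subseteq> E" "X \<noteq> {}" "closed X"
  show "\<exists>T\<subseteq>X. T \<noteq> {} \<and> extendable T \<and> linked T"
  proof (cases "\<exists>x\<in>X. mates x = {} \<or> card (sibs x) \<le> 1")
    case True
    then obtain x where x: "x \<in> X" "mates x = {} \<or> card (sibs x) \<le> 1" by blast
    then have "insert x (nbr x) \<subseteq> X" using X unfolding closed_def by blast
    moreover obtain T where "T \<subseteq> insert x (nbr x)" "T \<noteq> {}" "extendable T" "linked T"
      using low_degree_reducible[of x] x X by blast
    ultimately show ?thesis by (intro exI[of _ T]) auto
  next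
    case False
    interpret cubic_part E \<alpha> \<beta> L X
    proof
      fix x assume x: "x \<in> X"
      then have xE: "x \<in> E" using X by blast
      have "card (mates x) \<noteq> 0" using False x by simp
      then show "card (mates x) = 1" using card_mates[OF xE] by linarith
      have "\<not> card (sibs x) \<le> 1" using False x by blast
      then show "card (sibs x) = 2" using card_sibs[OF xE] by linarith
    qed (use X in simp_all)
    show ?thesis using X(2) by (rule cubic_reducible)
  qed
qed (rule card_nbr)

end

section \<open>Strong edge-colorings of (2,3)-bipartite graphs\<close>

lemma strong_list_coloring_2_3_bipartite:
  fixes L :: "'a set \<Rightarrow> 'c set"
  assumes G: "degree_bipartite_graph 2 3 V E" and L: "lists_of_size_at_least 6 E L"
  shows "\<exists>c. list_strong_edge_coloring E L c"
proof -
  obtain A B where bip: "bipartition V E A B"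
    and dA: "\<forall>a\<in>A. degree E a \<le> 2" and dB: "\<forall>b\<in>B. degree E b \<le> 3"
    and G': "simple_graph V E"
    using G unfolding degree_bipartite_graph_def by blast
  have AB: "A \<inter> B = {}" using bip unfolding bipartition_def by blast
  have finE: "finite E"
    using G' unfolding simple_graph_def by (metis Pow_iff finite_Pow_iff finite_subset subsetI)
  have "\<forall>e\<in>E. \<exists>p. fst p \<in> A \<and> snd p \<in> B \<and> e = {fst p, snd p}"
    using bip unfolding bipartition_def by fastforce
  then obtain ends where ends: "\<forall>e\<in>E. fst (ends e) \<in> A \<and> snd (ends e) \<in> B \<and> e = {fst (ends e), snd (ends e)}"
    by (rule bchoice[THEN exE])
  define \<alpha> \<beta> where "\<alpha> e = fst (ends e)" and "\<beta> e = snd (ends e)" for e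
  have \<alpha>\<beta>: "\<alpha> e \<in> A" "\<beta> e \<in> B" "e = {\<alpha> e, \<beta> e}" if "e \<in> E" for e
    using ends that unfolding \<alpha>_def \<beta>_def by blast+
  have mem: "\<alpha> e \<in> e" "\<beta> e \<in> e" if "e \<in> E" for e
    using equalityD2[OF \<alpha>\<beta>(3)[OF that]] by simp_all
  have memD: "w = \<alpha> e \<or> w = \<beta> e" if "e \<in> E" "w \<in> e" for w e
    using subsetD[OF equalityD1[OF \<alpha>\<beta>(3)[OF that(1)]] that(2)] by simp
  have "\<forall>e\<in>E. \<exists>K. K \<subseteq> L e \<and> card K = 6"
    using L unfolding lists_of_size_at_least_def
    by (metis infinite_arbitrarily_large obtain_subset_with_card_n)
  then obtain L6 where L6: "\<forall>e\<in>E. L6 e \<subseteq> L e \<and> card (L6 e) = 6"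
    by (rule bchoice[THEN exE])
  interpret two_three_incidences E \<alpha> \<beta> L6
  proof
    show "finite E" by (rule finE)
    show "x = y" if "x \<in> E" "y \<in> E" "\<alpha> x = \<alpha> y" "\<beta> x = \<beta> y" for x y
    proof -
      have "x = {\<alpha> y, \<beta> y}" using \<alpha>\<beta>(3)[OF that(1)] unfolding that(3,4) .
      also have "\<dots> = y" using \<alpha>\<beta>(3)[OF that(2)] by (rule sym)
      finally show ?thesis .
    qed
    show "card {y \<in> E. \<alpha> y = \<alpha> x} \<le> 2" if "x \<in> E" for x
    proof -
      have "{y \<in> E. \<alpha> y = \<alpha> x} \<subseteq> {e \<in> E. \<alpha> x \<in> e}" using mem(1) by force
      then have "card {y \<in> E. \<alpha> y = \<alpha> x} \<le> degree E (\<alpha> x)"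
        unfolding degree_def using finE by (intro card_mono) auto
      then show ?thesis using dA \<alpha>\<beta>(1)[OF that] by (meson le_trans)
    qed
    show "card {y \<in> E. \<beta> y = \<beta> x} \<le> 3" if "x \<in> E" for x
    proof -
      have "{y \<in> E. \<beta> y = \<beta> x} \<subseteq> {e \<in> E. \<beta> x \<in> e}" using mem(2) by force
      then have "card {y \<in> E. \<beta> y = \<beta> x} \<le> degree E (\<beta> x)"
        unfolding degree_def using finE by (intro card_mono) auto
      then show ?thesis using dB \<alpha>\<beta>(2)[OF that] by (meson le_trans)
    qed
    show "card (L6 x) = 6" if "x \<in> E" for x using L6 that by blast
  qed
  have adjI: "adj e f" if "e \<in> E" "f \<in> E" "w \<in> e" "w \<in> f" for e f w
  proof -
    have "w = \<alpha> e \<or> w = \<beta> e" "w = \<alpha> f \<or> w = \<beta> f" using that memD by simp_all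
    then show ?thesis
      using \<alpha>\<beta>(1,2)[OF that(1)] \<alpha>\<beta>(1,2)[OF that(2)] AB unfolding adj_def by auto
  qed
  obtain c where c: "colors_from L6 E c" using colorable_edges unfolding colorable_def by blast
  have "c e \<noteq> c f" if "e \<in> E" "f \<in> E" "e \<noteq> f" "e \<inter> f \<noteq> {}" for e f
  proof -
    have "adj e f" using adjI that by blast
    then have "conf e f" using that adj_refl unfolding conf_def by blast
    then show ?thesis using c that unfolding colors_from_def by blast
  qed
  moreover have "c e \<noteq> c f" if "e \<in> E" "f \<in> E" "e \<noteq> f" "joined_by_edge E e f" for e f
  proof -
    obtain x y where xy: "x \<in> e" "y \<in> f" "{x, y} \<in> E"
      using \<open>joined_by_edge E e f\<close> unfolding joined_by_edge_def by blast
    have "adj e {x, y}" "adj {x, y} f" using adjI xy that(1,2) by blast+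
    then have "conf e f" using that(3) xy(3) unfolding conf_def by blast
    then show ?thesis using c that unfolding colors_from_def by blast
  qed
  moreover have "\<forall>e\<in>E. c e \<in> L e" using c L6 unfolding colors_from_def by blast
  ultimately show ?thesis
    unfolding list_strong_edge_coloring_def strong_edge_coloring_def proper_edge_coloring_def by blast
qed

theorem theorem1:
  fixes V :: "'a set" and E :: "'a set set"
  assumes "degree_bipartite_graph 2 3 V E"
  shows "strong_edge_choosability E \<le> 6 \<and>
    (\<forall>L :: 'a set \<Rightarrow> 'c set.
       lists_of_size_at_least 6 E L \<longrightarrow> (\<exists>c. list_strong_edge_coloring E L c))"
proof
  show "strong_edge_choosability E \<le> 6"
    unfolding strong_edge_choosability_def
    using strong_list_coloring_2_3_bipartite[OF assms] by (intro Least_le) blast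
  show "\<forall>L :: 'a set \<Rightarrow> 'c set.
      lists_of_size_at_least 6 E L \<longrightarrow> (\<exists>c. list_strong_edge_coloring E L c)"
    using strong_list_coloring_2_3_bipartite[OF assms] by blast
qed

end
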